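(* Let $(\mathcal{B},\phi,\rho)$ be an expanding overlapping substitution in $\mathbb{R}^d$ with $\mathcal{B}=\{T_1,\dots,T_\kappa\}$, whose substitution matrix $M$ is primitive. Let $r=(r_1,\dots,r_\kappa)$ be a right Perron–Frobenius eigenvector of $M$, normalized in the following sense: $l=(l_1,\dots,l_\kappa)$ is the left Perron–Frobenius eigenvector of $M$ with $l_i=\operatorname{vol}(\operatorname{supp}T_i)$ for each $i$, and $\sum_{i=1}^{\kappa} l_ir_i=\sum_{i=1}^{\kappa} r_i=1$. Then $r$ gives the frequency for any fixed point of $\rho$. In particular, if $\mathcal{T}$ is a tiling of $\mathbb{R}^d$ consisting of translates of elements of $\mathcal{B}$ with $\rho^k(\mathcal{T})=\mathcal{T}$ for some integer $k>0$, then for any van Hove sequence $(A_n)$ in $\mathbb{R}^d$, any elements $x_n\in\mathbb{R}^d$ and every $i\in\{1,\dots,\kappa\}$, $$\lim_{n\to\infty}\frac{\operatorname{card}\{x\in A_n+x_n \mid T_i+x\in\mathcal{T}\}}{\operatorname{vol}(A_n)}=r_i ,$$ and the convergence is uniform for $(x_n)$.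
   Context: Tiles. A tile in $\mathbb{R}^d$ is either a nonempty compact set $S\subset\mathbb{R}^d$ with $S=\overline{S^\circ}$, or a pair $T=(S,l)$ of such a set with a label $l$ from a finite set; $\operatorname{supp}T=S$, $\operatorname{int}T=S^\circ$, and $T+x=(S+x,l)$. A pattern is a set of tiles; a patch is a pattern in which any two distinct tiles have disjoint interiors. The support of a patch is the union of the supports of its tiles; a tiling is a patch with support $\mathbb{R}^d$. $\operatorname{vol}$ is Lebesgue measure. Overlapping substitutions. A pre-overlapping substitution is a triple $(\mathcal{B},\phi,\rho)$ where $\mathcal{B}=\{T_1,\dots,T_\kappa\}$ is a finite set of tiles in $\mathbb{R}^d$ (the proto-tiles), $\phi:\mathbb{R}^d\to\mathbb{R}^d$ is a linear map all of whose eigenvalues are greater than $1$ in modulus, and $\rho$ assigns to each $T_i$ a finite patch $\rho(T_i)$ consisting of translates of elements of $\mathcal{B}$. Put $\rho(T_i+x)=\rho(T_i)+\phi(x)$ and $\rho(\mathcal{P})=\bigcup_{T\in\mathcal{P}}\rho(T)$ for a pattern $\mathcal{P}$ of translates of proto-tiles; iterates $\rho^n$ are defined accordingly. It is called an overlapping substitution (it is consistent) if $\rho^n(T_i)$ is a patch for all $n>0$ and all $i$. It is expanding if $\operatorname{supp}\rho(P)\supset\phi(\operatorname{supp}P)$ for every $P\in\mathcal{B}$. Substitution matrix. $M$ is the $\kappa\times\kappa$ matrix with entries $$M_{ij}=\sum_{x\in\mathbb{R}^d:\,T_i+x\in\rho(T_j)}\frac{\operatorname{vol}(\operatorname{supp}(T_i+x)\cap\phi(\operatorname{supp}T_j))}{\operatorname{vol}(\operatorname{supp}T_i)}.$$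 Perron–Frobenius eigenvectors are eigenvectors for the Perron–Frobenius eigenvalue of $M$. Van Hove sequence (standard notion): a sequence of bounded measurable sets $A_n\subset\mathbb{R}^d$ of positive volume such that for every $L>0$, $\operatorname{vol}(\partial^LA_n)/\operatorname{vol}(A_n)\to0$, where $\partial^LA=\{t\mid B(t,L)\cap A\neq\emptyset,\ B(t,L)\cap A^c\ne\emptyset\}$ and $B(t,L)$ is the ball of radius $L$ around $t$. "Uniform for $(x_n)$" means: for each $\varepsilon>0$ there is $N$ such that for all $n\ge N$ and all $x_n\in\mathbb{R}^d$ the quantity is within $\varepsilon$ of the limit.
   Formalization: Two conditions are added: each proto-tile's boundary has Lebesgue measure zero (with fat boundaries tiles overlap in positive volume and the frequency formula fails), and distinct proto-tiles are not translates of each other (else ρ may be ill-defined and tiles are counted twice). *)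

theory Defs
  imports "HOL-Analysis.Analysis"
begin

abbreviation vol :: "(real ^ 'd) set \<Rightarrow> real" where
  "vol \<equiv> measure lebesgue"

datatype ('d, 'l) tile =
    Unlabelled "(real ^ 'd) set"
  | Labelled "(real ^ 'd) set" 'l

primrec supp :: "('d::finite, 'l) tile \<Rightarrow> (real ^ 'd) set" where
  "supp (Unlabelled S) = S"
| "supp (Labelled S l) = S"

primrec translate_tile :: "real ^ 'd \<Rightarrow> ('d::finite, 'l) tile \<Rightarrow> ('d, 'l) tile" where
  "translate_tile x (Unlabelled S) = Unlabelled ((+) x ` S)"
| "translate_tile x (Labelled S l) = Labelled ((+) x ` S) l"

text \<open>The boundary of a tile may have positive volume: \<open>S = closure (interior S)\<close> does not
  exclude this, so a null boundary has to be assumed separately where it is needed.\<close>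

definition is_tile :: "('d::finite, 'l) tile \<Rightarrow> bool" where
  "is_tile U \<longleftrightarrow>
     supp U \<noteq> {} \<and> compact (supp U) \<and> supp U = closure (interior (supp U))"

definition pattern_supp :: "('d::finite, 'l) tile set \<Rightarrow> (real ^ 'd) set" where
  "pattern_supp P = (\<Union>U\<in>P. supp U)"

definition is_patch :: "('d::finite, 'l) tile set \<Rightarrow> bool" where
  "is_patch P \<longleftrightarrow>
     (\<forall>U\<in>P. is_tile U) \<and>
     (\<forall>U\<in>P. \<forall>V\<in>P. U \<noteq> V \<longrightarrow> interior (supp U) \<inter> interior (supp V) = {})"

definition is_tiling :: "('d::finite, 'l) tile set \<Rightarrow> bool" where
  "is_tiling P \<longleftrightarrow> is_patch P \<and> pattern_supp P = UNIV"

definition translates_of :: "('k \<Rightarrow> ('d::finite, 'l) tile) \<Rightarrow> ('d, 'l) tile set" where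
  "translates_of T = {translate_tile x (T i) | x i. True}"

definition eigenvalues :: "real ^ 'n ^ 'n \<Rightarrow> complex set" where
  "eigenvalues A =
     {z. \<exists>v :: complex ^ 'n. v \<noteq> 0 \<and> map_matrix complex_of_real A *v v = z *s v}"

text \<open>The power structure that the library puts on \<open>real ^ 'n ^ 'n\<close> is entrywise, hence the
  explicit iteration of the matrix product.\<close>

definition primitive_matrix :: "real ^ 'n ^ 'n \<Rightarrow> bool" where
  "primitive_matrix A \<longleftrightarrow>
     (\<forall>i j. 0 \<le> A $ i $ j) \<and>
     (\<exists>m>0. \<forall>i j. 0 < (((**) A ^^ m) (mat 1)) $ i $ j)"

definition is_PF_eigenvalue :: "real ^ 'n ^ 'n \<Rightarrow> real \<Rightarrow> bool" where
  "is_PF_eigenvalue A c \<longleftrightarrow>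
     complex_of_real c \<in> eigenvalues A \<and> (\<forall>z\<in>eigenvalues A. cmod z \<le> c)"

definition right_PF_eigenvector :: "real ^ 'n ^ 'n \<Rightarrow> real ^ 'n \<Rightarrow> bool" where
  "right_PF_eigenvector A r \<longleftrightarrow> r \<noteq> 0 \<and> (\<exists>c. is_PF_eigenvalue A c \<and> A *v r = c *s r)"

definition left_PF_eigenvector :: "real ^ 'n ^ 'n \<Rightarrow> real ^ 'n \<Rightarrow> bool" where
  "left_PF_eigenvector A l \<longleftrightarrow> l \<noteq> 0 \<and> (\<exists>c. is_PF_eigenvalue A c \<and> l v* A = c *s l)"

text \<open>The proto-tiles are given as a family \<open>T\<close> over a finite index type. Distinct indices have to
  carry proto-tiles that are not translates of each other: otherwise the prescription
  \<open>\<rho>(T\<^sub>i + x) = \<rho>(T\<^sub>i) + \<phi> x\<close> need not define \<open>\<rho>\<close> on translates of proto-tiles, and a tile would be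
  counted under several indices.\<close>

definition pre_overlapping_substitution ::
  "('k::finite \<Rightarrow> ('d::finite, 'l) tile) \<Rightarrow> (real ^ 'd \<Rightarrow> real ^ 'd) \<Rightarrow>
   ('k \<Rightarrow> ('d::finite, 'l) tile set) \<Rightarrow> bool" where
  "pre_overlapping_substitution T \<phi> \<rho> \<longleftrightarrow>
     (\<forall>i. is_tile (T i)) \<and>
     (\<forall>i j x. T i = translate_tile x (T j) \<longrightarrow> i = j) \<and>
     linear \<phi> \<and> (\<forall>z\<in>eigenvalues (matrix \<phi>). 1 < cmod z) \<and>
     (\<forall>i. finite (\<rho> i) \<and> is_patch (\<rho> i) \<and> \<rho> i \<subseteq> translates_of T)"

definition subst_tile ::
  "('k \<Rightarrow> ('d::finite, 'l) tile) \<Rightarrow> (real ^ 'd \<Rightarrow> real ^ 'd) \<Rightarrow> ('k \<Rightarrow> ('d, 'l) tile set) \<Rightarrow>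
   ('d::finite, 'l) tile \<Rightarrow> ('d, 'l) tile set" where
  "subst_tile T \<phi> \<rho> U = \<Union>{translate_tile (\<phi> x) ` \<rho> i | i x. U = translate_tile x (T i)}"

definition subst_pattern ::
  "('k \<Rightarrow> ('d::finite, 'l) tile) \<Rightarrow> (real ^ 'd \<Rightarrow> real ^ 'd) \<Rightarrow> ('k \<Rightarrow> ('d, 'l) tile set) \<Rightarrow>
   ('d::finite, 'l) tile set \<Rightarrow> ('d, 'l) tile set" where
  "subst_pattern T \<phi> \<rho> P = (\<Union>U\<in>P. subst_tile T \<phi> \<rho> U)"

definition overlapping_substitution ::
  "('k::finite \<Rightarrow> ('d::finite, 'l) tile) \<Rightarrow> (real ^ 'd \<Rightarrow> real ^ 'd) \<Rightarrow>
   ('k \<Rightarrow> ('d::finite, 'l) tile set) \<Rightarrow> bool" where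
  "overlapping_substitution T \<phi> \<rho> \<longleftrightarrow>
     pre_overlapping_substitution T \<phi> \<rho> \<and>
     (\<forall>n>0. \<forall>i. is_patch ((subst_pattern T \<phi> \<rho> ^^ n) {T i}))"

definition expanding ::
  "('k \<Rightarrow> ('d::finite, 'l) tile) \<Rightarrow> (real ^ 'd \<Rightarrow> real ^ 'd) \<Rightarrow> ('k \<Rightarrow> ('d, 'l) tile set) \<Rightarrow> bool" where
  "expanding T \<phi> \<rho> \<longleftrightarrow> (\<forall>i. \<phi> ` supp (T i) \<subseteq> pattern_supp (\<rho> i))"

definition substitution_matrix ::
  "('k::finite \<Rightarrow> ('d::finite, 'l) tile) \<Rightarrow> (real ^ 'd \<Rightarrow> real ^ 'd) \<Rightarrow>
   ('k \<Rightarrow> ('d::finite, 'l) tile set) \<Rightarrow> real ^ 'k ^ 'k" where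
  "substitution_matrix T \<phi> \<rho> =
     (\<chi> i j. \<Sum>x | translate_tile x (T i) \<in> \<rho> j.
        vol (supp (translate_tile x (T i)) \<inter> \<phi> ` supp (T j)) / vol (supp (T i)))"

definition thick_boundary :: "real \<Rightarrow> (real ^ 'd::finite) set \<Rightarrow> (real ^ 'd) set" where
  "thick_boundary L A = {t. ball t L \<inter> A \<noteq> {} \<and> ball t L \<inter> (- A) \<noteq> {}}"

definition van_Hove :: "(nat \<Rightarrow> (real ^ 'd::finite) set) \<Rightarrow> bool" where
  "van_Hove A \<longleftrightarrow>
     (\<forall>n. bounded (A n) \<and> A n \<in> sets lebesgue \<and> 0 < vol (A n)) \<and>
     (\<forall>L>0. (\<lambda>n. vol (thick_boundary L (A n)) / vol (A n)) \<longlonglongrightarrow> 0)"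

end

theory Submission
  imports Defs "HOL-Computational_Algebra.Fundamental_Theorem_Algebra"
begin

text \<open>For a patch \<open>P\<close> and a set \<open>B\<close> covered by it, consider the volume of the part of \<open>B\<close> that is
  covered by translates of \<open>T i\<close>. Inflating \<open>B\<close> by \<open>\<phi>\<close> to the power \<open>m\<close> transforms the vector of
  these volumes linearly, up to an error bounded by the volume of a thickened boundary, because
  inside the inflated support of a tile only the tiles of its own supertile are visible.
  Applied to supertiles, this shows that the proportions of the tile types in the supertiles of
  order \<open>m\<close> follow, up to errors tending to \<open>0\<close>, the iteration of a primitive stochastic matrix
  conjugate to a multiple of \<open>M\<close>, whence they converge to \<open>l i * r i\<close>. Applied to the fixed tiling and the
  deflation of \<open>A n\<close>, with \<open>m\<close> a large multiple of \<open>k\<close>, it gives the frequencies. Working with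
  supertiles of order \<open>m\<close> avoids intermediate patterns such as \<open>\<rho> \<T>\<close>, not known to be patches
  when \<open>k > 1\<close>.\<close>

subsection \<open>Contracting linear maps\<close>

text \<open>The obstacle is overlap: one tile of \<open>S P\<close> may belong to the supertiles of
  several tiles of \<open>P\<close>, so numbers of tiles do not add up over \<open>P\<close>.
  Volumes inside the inflated supports do add up, because these supports meet in null sets. Numbers
  of tiles appear only at the very end, where they differ from volumes by a boundary term. Two
  limits are taken in a fixed order. A large \<open>m\<close> makes the proportions in a supertile
  nearly independent of the type of the tile it comes from. With that \<open>m\<close> frozen, the
  remaining error is the volume of a thick boundary of fixed radius, which the van Hove property
  removes as \<open>n\<close> grows. Both terms are unchanged when \<open>A n\<close> is translated,
  whence the uniformity. Since \<phi> need not be a similarity, its expansion enters in one form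
  only: the iterates of its inverse tend to 0 in operator norm. This makes the boundary of a large
  supertile thin compared with its volume.\<close>

lemma tendsto_0_perturbed_contraction:
  fixes x f :: "nat \<Rightarrow> real"
  assumes nonneg: "\<And>m. 0 \<le> x m" and c: "0 \<le> c" "c < 1" and q: "0 < q"
    and step: "\<And>m. x (m + q) \<le> c * x m + f m" and f: "f \<longlonglongrightarrow> 0"
  shows "x \<longlonglongrightarrow> 0"
proof (rule LIMSEQ_I)
  fix e :: real assume e: "0 < e"
  \<comment> \<open>This value makes \<open>e / 2\<close> the fixed point of the map taking
    \<open>t\<close> to \<open>c * t + d\<close>, so the bound \<open>c ^ n * K + e / 2\<close>
    reproduces itself.\<close>
  define d where "d = (1 - c) * (e / 2)"
  have d: "0 < d" using e c by (simp add: d_def)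
  obtain M where M: "\<And>m. m \<ge> M \<Longrightarrow> f m \<le> d"
    using LIMSEQ_D[OF f d] by force
  \<comment> \<open>The recursion links only indices in the same residue class modulo
    \<open>q\<close>; \<open>K\<close> bounds the starting values of all these classes at
    once.\<close>
  define K where "K = (\<Sum>s<q. x (M + s))"
  have K: "x (M + s) \<le> K" if "s < q" for s
    unfolding K_def using that nonneg by (intro member_le_sum) auto
  have bound: "x (M + s + n * q) \<le> c ^ n * K + e / 2" if "s < q" for s n
  proof (induction n)
    case 0
    then show ?case using K[OF that] e by simp
  next
    case (Suc n)
    have "x (M + s + Suc n * q) = x ((M + s + n * q) + q)" by (simp add: algebra_simps)
    also have "\<dots> \<le> c * x (M + s + n * q) + d"
      using step[of "M + s + n * q"] M[of "M + s + n * q"] by simp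
    also have "\<dots> \<le> c * (c ^ n * K + e / 2) + d"
      using mult_left_mono[OF Suc c(1)] by simp
    also have "\<dots> = c ^ Suc n * K + e / 2" by (simp add: d_def field_simps)
    finally show ?case .
  qed
  have "(\<lambda>n. c ^ n * K) \<longlonglongrightarrow> 0 * K"
    using c by (intro tendsto_intros LIMSEQ_power_zero) auto
  then obtain n0 where n0: "\<And>n. n \<ge> n0 \<Longrightarrow> c ^ n * K < e / 2"
    using LIMSEQ_D[of "\<lambda>n. c ^ n * K" 0 "e / 2"] e by fastforce
  show "\<exists>no. \<forall>n\<ge>no. norm (x n - 0) < e"
  proof (intro exI allI impI)
    fix n assume n: "M + n0 * q \<le> n"
    define t where "t = n - M"
    have t: "n = M + t mod q + (t div q) * q" using n by (simp add: t_def)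
    have "t div q \<ge> n0" using n q by (simp add: t_def less_eq_div_iff_mult_less_eq)
    then have "x n < e" using bound[of "t mod q" "t div q"] n0[of "t div q"] q t by force
    then show "norm (x n - 0) < e" using nonneg[of n] by simp
  qed
qed

lemma norm_vector_scalar_mult_complex: "norm (z *s v) = cmod z * norm (v :: complex ^ 'n)"
  by (simp add: norm_vec_def norm_mult L2_set_right_distrib)

text \<open>Peel off a root \<open>z\<close> of the annihilating polynomial, so that the orbit of \<open>A v - z v\<close> tends
  to \<open>0\<close> by induction. If \<open>z\<close> lies in the open unit disc, the orbit of \<open>v\<close> is a perturbed
  contraction; otherwise \<open>z\<close> is no eigenvalue and \<open>A - z\<close> is bounded below.\<close>

lemma orbit_tendsto_0_if_annihilated:
  fixes A :: "complex ^ 'n ^ 'n"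
  assumes eig: "\<And>z w. w \<noteq> 0 \<Longrightarrow> A *v w = z *s w \<Longrightarrow> cmod z < 1"
  shows "degree p = n \<Longrightarrow> p \<noteq> 0 \<Longrightarrow> (\<Sum>i\<le>n. coeff p i *s ((*v) A ^^ i) v) = 0 \<Longrightarrow>
    (\<lambda>m. ((*v) A ^^ m) v) \<longlonglongrightarrow> 0"
proof (induction n arbitrary: p v)
  case 0
  then have "coeff p 0 \<noteq> 0" by (metis leading_coeff_0_iff)
  with 0 have "v = 0" by simp
  moreover have "((*v) A ^^ m) 0 = 0" for m
    by (induction m) auto
  ultimately show ?case by simp
next
  case (Suc n)
  let ?f = "(*v) A"
  have "\<not> constant (poly p)" using Suc.prems(1) by (simp add: constant_degree)
  then obtain z where "poly p z = 0" using fundamental_theorem_of_algebra by blast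
  then obtain q where pq: "p = [:- z, 1:] * q" by (auto simp: poly_eq_0_iff_dvd elim: dvdE)
  have q0: "q \<noteq> 0" using Suc.prems(2) pq by auto
  have dq: "degree q = n" using Suc.prems(1) degree_mult_eq[of "[:- z, 1:]" q] q0 unfolding pq by simp
  define g where "g = (\<lambda>w. A *v w - z *s w)"
  have comm: "(?f ^^ m) (g w) = g ((?f ^^ m) w)" for m w
  proof (induction m)
    case (Suc m)
    then show ?case
      by (simp add: g_def matrix_vector_mult_diff_distrib vector_scalar_commute)
  qed simp
  \<comment> \<open>Comparing coefficients in \<open>p = (X - z) q\<close> turns the relation for
    \<open>v\<close> into one with the polynomial \<open>q\<close> for \<open>g v\<close>.\<close>
  have coeffs: "coeff p i = (if i = 0 then 0 else coeff q (i - 1)) - z * coeff q i" for i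
    unfolding pq by (cases i) (simp_all add: coeff_pCons)
  have "(\<Sum>i\<le>Suc n. coeff p i *s (?f ^^ i) v) =
      (\<Sum>i\<le>Suc n. (if i = 0 then 0 else coeff q (i - 1)) *s (?f ^^ i) v) -
      (\<Sum>i\<le>Suc n. z *s (coeff q i *s (?f ^^ i) v))"
    unfolding coeffs
    by (simp add: vector_sub_rdistrib sum_subtractf vector_smult_assoc del: sum.atMost_Suc)
  also have "(\<Sum>i\<le>Suc n. (if i = 0 then 0 else coeff q (i - 1)) *s (?f ^^ i) v)
      = (\<Sum>i\<le>n. coeff q i *s (A *v (?f ^^ i) v))"
    by (subst sum.atMost_Suc_shift) simp
  also have "(\<Sum>i\<le>Suc n. z *s (coeff q i *s (?f ^^ i) v))
      = (\<Sum>i\<le>n. z *s (coeff q i *s (?f ^^ i) v))"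
    using dq by (simp add: coeff_eq_0)
  also have "(\<Sum>i\<le>n. coeff q i *s (A *v (?f ^^ i) v)) - \<dots> = (\<Sum>i\<le>n. coeff q i *s (?f ^^ i) (g v))"
    unfolding comm by (simp add: g_def vector_ssub_ldistrib sum_subtractf vector_smult_assoc mult.commute)
  finally have "(\<Sum>i\<le>n. coeff q i *s (?f ^^ i) (g v)) = 0" using Suc.prems(3) by simp
  from Suc.IH[OF dq q0 this] have lim: "(\<lambda>m. (?f ^^ m) (g v)) \<longlonglongrightarrow> 0" .
  show ?case
  proof (cases "cmod z < 1")
    case True
    have "(\<lambda>m. norm ((?f ^^ m) v)) \<longlonglongrightarrow> 0"
    proof (rule tendsto_0_perturbed_contraction[of _ "cmod z" 1 "\<lambda>m. norm ((?f ^^ m) (g v))"])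
      fix m
      have "(?f ^^ (m + 1)) v = z *s (?f ^^ m) v + (?f ^^ m) (g v)"
        unfolding comm by (simp add: g_def)
      then show "norm ((?f ^^ (m + 1)) v) \<le> cmod z * norm ((?f ^^ m) v) + norm ((?f ^^ m) (g v))"
        by (metis norm_triangle_ineq norm_vector_scalar_mult_complex)
    qed (use True lim in \<open>auto intro: tendsto_norm_zero\<close>)
    then show ?thesis by (rule tendsto_norm_zero_cancel)
  next
    case False
    have "linear g"
      by (rule linearI) (simp_all add: g_def matrix_vector_mult_add_rdistrib vector_add_ldistrib
          scaleR_matrix_vector_assoc scalar_mult_eq_scaleR vector_scalar_mult_def vec_eq_iff
          matrix_vector_mult_def scaleR_sum_right sum.distrib algebra_simps)
    moreover have "inj g"
      unfolding linear_injective_0[OF \<open>linear g\<close>] using eig[of _ z] False by (auto simp: g_def)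
    ultimately obtain B where B: "B > 0" "\<And>w. B * norm w \<le> norm (g w)"
      using linear_inj_bounded_below_pos by blast
    have "(\<lambda>m. norm ((?f ^^ m) (g v)) / B) \<longlonglongrightarrow> 0 / B"
      using lim B by (intro tendsto_intros tendsto_norm_zero) auto
    then have "(\<lambda>m. norm ((?f ^^ m) (g v)) / B) \<longlonglongrightarrow> 0" by simp
    then show ?thesis
      by (rule Lim_null_comparison[rotated])
        (use B in \<open>auto simp: comm field_simps\<close>)
  qed
qed

text \<open>There is one vector more than the dimension. Dependence is a property of the set of
  values, so a repeated value is treated apart: it yields the relation
  \<open>x i - x j = 0\<close>.\<close>

lemma ex_linear_relation:
  fixes x :: "nat \<Rightarrow> 'a::euclidean_space"
  shows "\<exists>c. (\<exists>i\<le>DIM('a). c i \<noteq> 0) \<and> (\<Sum>i\<le>DIM('a). c i *\<^sub>R x i) = 0"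
proof (cases "inj_on x {..DIM('a)}")
  case True
  then have "dependent (x ` {..DIM('a)})"
    by (intro dependent_biggerset) (simp add: card_image)
  then obtain u where u: "\<exists>v\<in>x ` {..DIM('a)}. u v \<noteq> 0" "(\<Sum>v\<in>x ` {..DIM('a)}. u v *\<^sub>R v) = 0"
    by (auto simp: dependent_finite)
  with True show ?thesis
    by (intro exI[of _ "u \<circ> x"]) (auto simp: sum.reindex)
next
  case False
  then obtain i j where ij: "i \<le> DIM('a)" "j \<le> DIM('a)" "x i = x j" "i \<noteq> j"
    by (auto simp: inj_on_def)
  have "(\<Sum>m\<le>DIM('a). (if m = i then 1 else if m = j then - 1 else 0) *\<^sub>R x m)
     = (\<Sum>m\<in>{i, j}. (if m = i then 1 else if m = j then - 1 else 0) *\<^sub>R x m)"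
    using ij by (intro sum.mono_neutral_right) auto
  also have "\<dots> = 0" using ij by simp
  finally show ?thesis using ij by (intro exI conjI) auto
qed

text \<open>A linear relation among the first iterates of \<open>v\<close> is an annihilating
  polynomial for \<open>v\<close>. Its coefficients are real because \<open>DIM\<close> is the
  dimension over the reals.\<close>

lemma orbit_tendsto_0:
  fixes A :: "complex ^ 'n ^ 'n"
  assumes eig: "\<And>z w. w \<noteq> 0 \<Longrightarrow> A *v w = z *s w \<Longrightarrow> cmod z < 1"
  shows "(\<lambda>m. ((*v) A ^^ m) v) \<longlonglongrightarrow> 0"
proof -
  let ?N = "DIM(complex ^ 'n)"
  obtain c i where c: "i \<le> ?N" "c i \<noteq> 0" "(\<Sum>i\<le>?N. c i *\<^sub>R ((*v) A ^^ i) v) = 0"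
    using ex_linear_relation[of "\<lambda>i. ((*v) A ^^ i) v"] by blast
  define p :: "complex poly" where "p = (\<Sum>i\<le>?N. monom (of_real (c i)) i)"
  have coeff: "coeff p i = (if i \<le> ?N then of_real (c i) else 0)" for i
    by (simp add: p_def coeff_sum)
  have deg: "degree p \<le> ?N"
    by (rule degree_le) (simp add: coeff)
  have "p \<noteq> 0" using c coeff[of i] by auto
  have "(\<Sum>i\<le>degree p. coeff p i *s ((*v) A ^^ i) v) = (\<Sum>i\<le>?N. coeff p i *s ((*v) A ^^ i) v)"
    using deg by (intro sum.mono_neutral_left) (auto simp: coeff_eq_0)
  also have "\<dots> = (\<Sum>i\<le>?N. c i *\<^sub>R ((*v) A ^^ i) v)"
    by (intro sum.cong) (auto simp: coeff vec_eq_iff scaleR_conv_of_real[where 'a = complex])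
  finally show ?thesis
    using orbit_tendsto_0_if_annihilated[OF eig refl \<open>p \<noteq> 0\<close>] c by simp
qed

text \<open>The complex eigenvalues of the inverse are reciprocals of those of \<phi>, hence lie in
  the open unit disc; real orbits are embedded into the complex space to exploit this.\<close>

lemma ex_contracting_inverse:
  fixes \<phi> :: "real ^ 'd \<Rightarrow> real ^ 'd"
  assumes lin: "linear \<phi>" and eig: "\<And>z. z \<in> eigenvalues (matrix \<phi>) \<Longrightarrow> 1 < cmod z"
  obtains \<psi> where "linear \<psi>" "\<And>x. \<phi> (\<psi> x) = x" "\<And>x. \<psi> (\<phi> x) = x"
    "\<And>e. 0 < e \<Longrightarrow> \<forall>\<^sub>F m in sequentially. \<forall>v. norm ((\<psi> ^^ m) v) \<le> e * norm v"
proof -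
  let ?C = "map_matrix complex_of_real"
  define cv :: "real ^ 'd \<Rightarrow> complex ^ 'd" where "cv v = (\<chi> i. of_real (v $ i))" for v
  have C: "?C A *v cv v = cv (A *v v)" for A v
    by (simp add: vec_eq_iff map_matrix_def matrix_vector_mult_def cv_def)
  have "inj \<phi>"
    unfolding linear_injective_0[OF lin]
  proof (intro allI impI)
    fix v assume v: "\<phi> v = 0"
    then have "?C (matrix \<phi>) *v cv v = 0 *s cv v"
      unfolding C by (simp add: matrix_vector_mul(2)[THEN fun_cong, OF lin] cv_def vec_eq_iff)
    moreover have "0 \<notin> eigenvalues (matrix \<phi>)" using eig[of 0] by auto
    ultimately have "cv v = 0" unfolding eigenvalues_def by blast
    then show "v = 0" by (simp add: cv_def vec_eq_iff)
  qed
  then obtain \<psi> where \<psi>: "linear \<psi>" "\<psi> \<circ> \<phi> = id"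
    using linear_injective_left_inverse[OF lin] by blast
  have \<psi>\<phi>: "\<psi> (\<phi> x) = x" for x using \<psi>(2) by (simp add: fun_eq_iff)
  moreover have \<phi>\<psi>: "\<phi> (\<psi> x) = x" for x
    using linear_inverse_left[OF lin \<psi>(1)] \<psi>(2) by (simp add: fun_eq_iff)
  have inv: "matrix \<phi> ** matrix \<psi> = mat 1"
    using matrix_compose[OF \<psi>(1) lin] \<phi>\<psi> by (simp add: comp_def matrix_id_mat_1[unfolded id_def])
  have Cinv: "?C (matrix \<phi>) ** ?C (matrix \<psi>) = mat 1"
  proof -
    have "?C (matrix \<phi>) ** ?C (matrix \<psi>) = ?C (matrix \<phi> ** matrix \<psi>)"
      by (simp add: vec_eq_iff map_matrix_def matrix_matrix_mult_def)
    then show ?thesis unfolding inv by (simp add: vec_eq_iff map_matrix_def mat_def)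
  qed
  have small: "cmod z < 1" if "w \<noteq> 0" "?C (matrix \<psi>) *v w = z *s w" for z w
  proof -
    have w: "w = z *s (?C (matrix \<phi>) *v w)"
      by (metis Cinv matrix_vector_mul_assoc matrix_vector_mul_lid that(2) vector_scalar_commute)
    then have "z \<noteq> 0" using that(1) by auto
    then have "?C (matrix \<phi>) *v w = inverse z *s w"
      by (subst (2) w) (simp add: vector_smult_assoc)
    then have "1 < cmod (inverse z)" using eig that(1) unfolding eigenvalues_def by blast
    then show ?thesis using \<open>z \<noteq> 0\<close> by (simp add: norm_divide field_simps)
  qed
  have Cpow: "((*v) (map_matrix complex_of_real (matrix \<psi>)) ^^ m) (cv v) = cv ((\<psi> ^^ m) v)" for m v
    by (induction m) (simp_all add: C matrix_vector_mul(2)[THEN fun_cong, OF \<psi>(1)])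
  have lin_pow: "linear (\<psi> ^^ m)" for m
    using linear_compose[OF _ \<psi>(1)] linear_id by (induction m) (auto simp: comp_def id_def)
  have lim: "(\<lambda>m. (\<psi> ^^ m) v) \<longlonglongrightarrow> 0" for v
  proof (rule vec_tendstoI)
    fix i
    have "(\<lambda>m. cv ((\<psi> ^^ m) v)) \<longlonglongrightarrow> 0"
      unfolding Cpow[symmetric] by (rule orbit_tendsto_0) (rule small)
    from tendsto_vec_nth[OF this, of i] have "(\<lambda>m. complex_of_real ((\<psi> ^^ m) v $ i)) \<longlonglongrightarrow> complex_of_real 0"
      by (simp add: cv_def)
    then show "(\<lambda>m. (\<psi> ^^ m) v $ i) \<longlonglongrightarrow> 0 $ i"
      unfolding tendsto_of_real_iff by simp
  qed
  have "\<forall>\<^sub>F m in sequentially. \<forall>v. norm ((\<psi> ^^ m) v) \<le> e * norm v" if e: "0 < e" for e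
  proof -
    \<comment> \<open>Convergence on the finitely many basis vectors controls the operator norm,
      which makes the bound uniform in \<open>v\<close>.\<close>
    have "(\<lambda>m. \<Sum>b\<in>Basis. norm ((\<psi> ^^ m) b)) \<longlonglongrightarrow> (\<Sum>b\<in>(Basis :: (real ^ 'd) set). 0)"
      by (intro tendsto_sum tendsto_norm_zero lim)
    then have "(\<lambda>m. \<Sum>b\<in>Basis. norm ((\<psi> ^^ m) b)) \<longlonglongrightarrow> 0" by simp
    from order_tendstoD(2)[OF this e]
    show ?thesis
    proof (rule eventually_mono, intro allI)
      fix m and v :: "real ^ 'd" assume m: "(\<Sum>b\<in>Basis. norm ((\<psi> ^^ m) b)) < e"
      have "(\<psi> ^^ m) v = (\<psi> ^^ m) (\<Sum>b\<in>Basis. (v \<bullet> b) *\<^sub>R b)" by (simp add: euclidean_representation)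
      also have "\<dots> = (\<Sum>b\<in>Basis. (v \<bullet> b) *\<^sub>R (\<psi> ^^ m) b)"
        using lin_pow by (simp add: linear_sum linear_cmul)
      also have "norm \<dots> \<le> (\<Sum>b\<in>Basis. norm v * norm ((\<psi> ^^ m) b))"
        by (rule sum_norm_le) (auto intro!: mult_right_mono Basis_le_norm)
      also have "\<dots> \<le> e * norm v"
        using mult_left_mono[OF less_imp_le[OF m] norm_ge_zero[of v]]
        by (simp add: sum_distrib_left[symmetric] mult.commute)
      finally show "norm ((\<psi> ^^ m) v) \<le> e * norm v" .
    qed
  qed
  then show thesis using that \<psi>(1) \<phi>\<psi> \<psi>\<phi> by blast
qed

subsection \<open>Primitive stochastic matrices\<close>

text \<open>Column sums control the operator norm on \<open>l^1\<close>. The bound is needed with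
  \<open>s = 1\<close> for a stochastic matrix and with \<open>s < 1\<close> after a constant has
  been subtracted from all entries.\<close>

lemma sum_abs_matrix_vector_mult_le:
  fixes N :: "real ^ 'k ^ 'k"
  assumes N: "\<And>i j. 0 \<le> N $ i $ j" and col: "\<And>j. (\<Sum>i\<in>UNIV. N $ i $ j) \<le> s"
  shows "(\<Sum>i\<in>UNIV. \<bar>(N *v v) $ i\<bar>) \<le> s * (\<Sum>i\<in>UNIV. \<bar>v $ i\<bar>)"
proof -
  have "(\<Sum>i\<in>UNIV. \<bar>(N *v v) $ i\<bar>) \<le> (\<Sum>i\<in>UNIV. \<Sum>j\<in>UNIV. N $ i $ j * \<bar>v $ j\<bar>)"
    by (intro sum_mono) (auto simp: matrix_vector_mult_def abs_mult N intro!: order_trans[OF sum_abs])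
  also have "\<dots> = (\<Sum>j\<in>UNIV. (\<Sum>i\<in>UNIV. N $ i $ j) * \<bar>v $ j\<bar>)"
    by (subst sum.swap) (simp add: sum_distrib_right)
  also have "\<dots> \<le> (\<Sum>j\<in>UNIV. s * \<bar>v $ j\<bar>)"
    by (intro sum_mono mult_right_mono col) auto
  finally show ?thesis by (simp add: sum_distrib_left)
qed

lemma stochastic_matrix_power:
  fixes N :: "real ^ 'k ^ 'k"
  assumes N: "\<And>i j. 0 \<le> N $ i $ j" and col: "\<And>j. (\<Sum>i\<in>UNIV. N $ i $ j) = 1"
  shows "0 \<le> (((**) N ^^ q) (mat 1)) $ i $ j" "(\<Sum>i\<in>UNIV. (((**) N ^^ q) (mat 1)) $ i $ j) = 1"
proof -
  show "0 \<le> (((**) N ^^ q) (mat 1)) $ i $ j"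
    by (induction q arbitrary: i j) (auto simp: mat_def matrix_matrix_mult_def N intro!: sum_nonneg)
  show "(\<Sum>i\<in>UNIV. (((**) N ^^ q) (mat 1)) $ i $ j) = 1"
  proof (induction q)
    case (Suc q)
    have "(\<Sum>i\<in>UNIV. (((**) N ^^ Suc q) (mat 1)) $ i $ j) =
        (\<Sum>p\<in>UNIV. (\<Sum>i\<in>UNIV. N $ i $ p) * (((**) N ^^ q) (mat 1)) $ p $ j)"
      by (simp add: matrix_matrix_mult_def sum_distrib_right) (rule sum.swap)
    then show ?case using Suc col by simp
  qed (simp add: mat_def)
qed

text \<open>Doeblin's argument: a positive stochastic matrix dominates a rank-one matrix that kills
  vectors with vanishing coordinate sum, so it strictly contracts their \<open>l\<^sup>1\<close>-norm.\<close>

lemma perturbed_stochastic_iteration: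
  fixes N :: "real ^ 'k ^ 'k" and a :: "nat \<Rightarrow> real ^ 'k"
  assumes N: "\<And>i j. 0 \<le> N $ i $ j" and col: "\<And>j. (\<Sum>i\<in>UNIV. N $ i $ j) = 1"
    and pos: "\<And>i j. 0 < (((**) N ^^ q) (mat 1)) $ i $ j" and q: "0 < q"
    and p: "N *v p = p" "(\<Sum>i\<in>UNIV. p $ i) = 1"
    and a: "\<And>m. (\<Sum>i\<in>UNIV. a m $ i) = 1"
    and e: "\<And>i. (\<lambda>m. a (Suc m) $ i - (N *v a m) $ i) \<longlonglongrightarrow> 0"
  shows "(\<lambda>m. a m $ i) \<longlonglongrightarrow> p $ i"
proof -
  define nm where "nm v = (\<Sum>i\<in>UNIV. \<bar>v $ i\<bar>)" for v :: "real ^ 'k"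
  have nm_add: "nm (v + w) \<le> nm v + nm w" for v w
    unfolding nm_def by (simp add: sum.distrib[symmetric] sum_mono)
  define Q where "Q = ((**) N ^^ q) (mat 1)"
  have Q: "0 \<le> Q $ i $ j" "(\<Sum>i\<in>UNIV. Q $ i $ j) = 1" for i j
    unfolding Q_def using stochastic_matrix_power[OF N col] by auto
  have Npow: "((*v) N ^^ t) v = ((**) N ^^ t) (mat 1) *v v" for t v
    by (induction t) (auto simp: matrix_vector_mul_assoc[symmetric])
  define \<delta> where "\<delta> = Min (range (\<lambda>(i, j). Q $ i $ j))"
  have \<delta>: "\<delta> \<le> Q $ i $ j" for i j
    unfolding \<delta>_def by (rule Min_le) (auto intro: range_eqI[of _ _ "(i, j)"])
  have \<delta>0: "0 < \<delta>" unfolding \<delta>_def using pos by (subst Min_gr_iff) (auto simp: Q_def)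
  \<comment> \<open>The common column sum of \<open>Q\<close> after subtracting \<delta> from every
    entry; it is nonnegative because a column of \<open>Q\<close> has sum 1.\<close>
  define c where "c = 1 - \<delta> * real CARD('k)"
  have c1: "c < 1" using \<delta>0 by (simp add: c_def)
  have "\<delta> * real CARD('k) = (\<Sum>i\<in>(UNIV :: 'k set). \<delta>)" by simp
  also have "\<dots> \<le> 1" using sum_mono[of UNIV "\<lambda>i. \<delta>" "\<lambda>i. Q $ i $ j" for j] \<delta> Q(2) by metis
  finally have c0: "0 \<le> c" by (simp add: c_def)
  have contr: "nm (Q *v v) \<le> c * nm v" if "(\<Sum>i\<in>UNIV. v $ i) = 0" for v
  proof -
    have "Q *v v = (\<chi> i j. Q $ i $ j - \<delta>) *v v"
      using that by (simp add: vec_eq_iff matrix_vector_mult_def left_diff_distrib sum_subtractf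
          flip: sum_distrib_left)
    then show ?thesis unfolding nm_def
      using sum_abs_matrix_vector_mult_le[of "\<chi> i j. Q $ i $ j - \<delta>" c v] \<delta> Q
      by (simp add: sum_subtractf c_def mult.commute)
  qed
  define b where "b m = a m - p" for m
  define d where "d m = a (Suc m) - N *v a m" for m
  have b_Suc: "b (Suc m) = N *v b m + d m" for m
    by (simp add: b_def d_def matrix_vector_mult_diff_distrib p)
  have split: "nm (b (m + t) - ((*v) N ^^ t) (b m)) \<le> (\<Sum>s<t. nm (d (m + s)))" for m t
  proof (induction t)
    case (Suc t)
    have "b (m + Suc t) - ((*v) N ^^ Suc t) (b m)
        = N *v (b (m + t) - ((*v) N ^^ t) (b m)) + d (m + t)"
      by (simp add: b_Suc matrix_vector_mult_diff_distrib)
    then have "nm (b (m + Suc t) - ((*v) N ^^ Suc t) (b m))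
        \<le> nm (N *v (b (m + t) - ((*v) N ^^ t) (b m))) + nm (d (m + t))"
      by (metis nm_add)
    also have "nm (N *v (b (m + t) - ((*v) N ^^ t) (b m))) \<le> nm (b (m + t) - ((*v) N ^^ t) (b m))"
      using sum_abs_matrix_vector_mult_le[of N 1 "b (m + t) - ((*v) N ^^ t) (b m)"] N col
      unfolding nm_def by simp
    finally show ?case using Suc by simp
  qed (simp add: nm_def)
  have "(\<lambda>m. nm (b m)) \<longlonglongrightarrow> 0"
  proof (rule tendsto_0_perturbed_contraction[OF _ c0 c1 q])
    show "nm (b (m + q)) \<le> c * nm (b m) + (\<Sum>s<q. nm (d (m + s)))" for m
    proof -
      have "nm (b (m + q)) \<le> nm (((*v) N ^^ q) (b m)) + nm (b (m + q) - ((*v) N ^^ q) (b m))"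
        using nm_add[of "((*v) N ^^ q) (b m)" "b (m + q) - ((*v) N ^^ q) (b m)"] by simp
      moreover have "nm (((*v) N ^^ q) (b m)) \<le> c * nm (b m)"
        unfolding Npow Q_def[symmetric] by (rule contr) (simp add: b_def sum_subtractf a p)
      ultimately show ?thesis using split[of m q] by simp
    qed
    have "(\<lambda>m. \<bar>d m $ i\<bar>) \<longlonglongrightarrow> 0" for i
      using tendsto_rabs[OF e[of i]] by (simp add: d_def)
    then have "(\<lambda>m. nm (d m)) \<longlonglongrightarrow> 0"
      unfolding nm_def by (rule tendsto_null_sum)
    then have "(\<lambda>m. nm (d (m + s))) \<longlonglongrightarrow> 0" for s
      by (rule LIMSEQ_ignore_initial_segment)
    then show "(\<lambda>m. \<Sum>s<q. nm (d (m + s))) \<longlonglongrightarrow> 0"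
      by (intro tendsto_null_sum)
  qed (simp add: nm_def sum_nonneg)
  then have "(\<lambda>m. b m $ i) \<longlonglongrightarrow> 0"
    by (rule Lim_null_comparison[rotated]) (auto simp: nm_def intro!: always_eventually member_le_sum)
  then show ?thesis using Lim_null[of "\<lambda>m. a m $ i"] by (simp add: b_def)
qed

subsection \<open>Thickened boundaries and volumes\<close>

text \<open>Both factors are unions of open balls, so a thick boundary is open whatever
  \<open>A\<close> is.\<close>

lemma thick_boundary_eq: "thick_boundary L A = (\<Union>a\<in>A. ball a L) \<inter> (\<Union>a\<in>- A. ball a L)"
  by (auto simp: thick_boundary_def dist_commute)

lemma thick_boundary_mono: "L \<le> L' \<Longrightarrow> thick_boundary L A \<subseteq> thick_boundary L' A"
  unfolding thick_boundary_eq by (intro Int_mono UN_mono subset_ball order_refl)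

lemma lmeasurable_thick_boundary:
  assumes "bounded A"
  shows "thick_boundary L A \<in> lmeasurable"
proof -
  obtain B where "\<And>a. a \<in> A \<Longrightarrow> norm a \<le> B" using assms by (auto simp: bounded_iff)
  then have "norm x \<le> B + L" if "a \<in> A" "dist a x < L" for a x
    using norm_triangle_ineq2[of x a] that by (force simp: dist_norm norm_minus_commute)
  then have "bounded (thick_boundary L A)"
    unfolding thick_boundary_eq bounded_iff by (intro exI[of _ "B + L"]) auto
  moreover have "open (thick_boundary L A)"
    unfolding thick_boundary_eq by (intro open_Int open_UN) auto
  ultimately show ?thesis by (rule lmeasurable_open)
qed

lemma vol_thick_boundary_mono:
  assumes "bounded A" "L \<le> L'"
  shows "vol (thick_boundary L A) \<le> vol (thick_boundary L' A)"
  using assms by (intro measure_mono_fmeasurable thick_boundary_mono fmeasurableD lmeasurable_thick_boundary)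

lemma thick_boundary_translation: "thick_boundary L ((+) z ` A) = (+) z ` thick_boundary L A"
proof -
  have *: "ball t L \<inter> (+) z ` X \<noteq> {} \<longleftrightarrow> ball (t - z) L \<inter> X \<noteq> {}" for t X
    by (auto simp: disjoint_iff dist_norm algebra_simps)
  have "- (+) z ` A = (+) z ` (- A)" by (simp add: bij_image_Compl_eq)
  then have "t \<in> thick_boundary L ((+) z ` A) \<longleftrightarrow> t - z \<in> thick_boundary L A" for t
    unfolding thick_boundary_def by (simp add: *)
  moreover have "t \<in> (+) z ` X \<longleftrightarrow> t - z \<in> X" for t X
    by (auto simp: image_iff intro!: bexI[of _ "t - z"])
  ultimately show ?thesis by blast
qed

text \<open>Each point of \<open>S\<close> is within \<open>R\<close> of a point of \<open>S\<close>
  inside \<open>A\<close> and of one outside. This is how tiles straddling a boundary are charged to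
  its volume.\<close>

lemma subset_thick_boundary:
  assumes "\<And>x y. x \<in> S \<Longrightarrow> y \<in> S \<Longrightarrow> dist x y < R" "S \<inter> A \<noteq> {}" "\<not> S \<subseteq> A"
  shows "S \<subseteq> thick_boundary R A"
  using assms by (fastforce simp: thick_boundary_def)

text \<open>Points at distance below \<open>R\<close> are brought by \<open>g\<close> to distance
  below \<delta>. The factor \<open>c\<close> may exceed 1: the lemma serves for inflation, with
  \<open>c\<close> small, and for deflation, with \<open>c\<close> large.\<close>

lemma thick_boundary_linear_image:
  assumes g: "linear g" and fg: "\<And>x. f (g x) = x" and gf: "\<And>x. g (f x) = x"
    and c: "\<And>v. norm (g v) \<le> c * norm v" "0 \<le> c" "c * R < \<delta>"
  shows "thick_boundary R (f ` S) \<subseteq> f ` thick_boundary \<delta> S"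
proof
  fix t assume t: "t \<in> thick_boundary R (f ` S)"
  have near: "ball (g t) \<delta> \<inter> X \<noteq> {}" if "ball t R \<inter> f ` X \<noteq> {}" for X
  proof -
    obtain s where s: "s \<in> X" "dist t (f s) < R" using \<open>ball t R \<inter> f ` X \<noteq> {}\<close> by auto
    have "dist (g t) s = norm (g (t - f s))" using g by (simp add: linear_diff gf dist_norm)
    also have "\<dots> \<le> c * dist t (f s)" unfolding dist_norm by (rule c)
    also have "\<dots> \<le> c * R" using s c by (intro mult_left_mono) auto
    also have "\<dots> < \<delta>" by (rule c)
    finally show ?thesis using s by auto
  qed
  have "bij f" using fg gf by (metis bijI')
  then have "- f ` S = f ` (- S)" by (simp add: bij_image_Compl_eq)
  then have "g t \<in> thick_boundary \<delta> S"
    using t near[of S] near[of "- S"] by (simp add: thick_boundary_def)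
  then show "t \<in> f ` thick_boundary \<delta> S" by (metis fg image_eqI)
qed

text \<open>The thick boundaries of radius \<open>1 / (n + 1)\<close> decrease to a subset of the
  frontier, and boundedness makes their volumes finite, so continuity from above applies.\<close>

lemma vol_thick_boundary_small:
  assumes S: "bounded S" "negligible (frontier S)" and e: "0 < e"
  shows "\<exists>\<delta>>0. vol (thick_boundary \<delta> S) < e"
proof -
  define D where "D n = thick_boundary (inverse (real (Suc n))) S" for n
  have D: "D n \<in> lmeasurable" for n
    unfolding D_def by (rule lmeasurable_thick_boundary[OF S(1)])
  have "(\<Inter>n. D n) \<subseteq> frontier S"
  proof
    fix t assume t: "t \<in> (\<Inter>n. D n)"
    have "t \<in> closure X" if X: "\<And>n. ball t (inverse (real (Suc n))) \<inter> X \<noteq> {}" for X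
      unfolding closure_approachable
    proof (intro allI impI)
      fix e :: real assume "0 < e"
      then obtain n where "inverse (real (Suc n)) < e" using reals_Archimedean by blast
      then show "\<exists>y\<in>X. dist y t < e" using X[of n] by (force simp: dist_commute)
    qed
    then have "t \<in> closure S" "t \<in> closure (- S)"
      using t by (auto simp: D_def thick_boundary_def)
    then show "t \<in> frontier S" by (simp add: frontier_closures)
  qed
  then have "negligible (\<Inter>n. D n)" using S(2) negligible_subset by blast
  moreover have "(\<lambda>n. vol (D n)) \<longlonglongrightarrow> vol (\<Inter>n. D n)"
  proof (rule Lim_measure_decseq)
    show "decseq D"
      unfolding D_def by (intro decseq_SucI thick_boundary_mono) (simp add: field_simps)
  qed (use D fmeasurableD2[OF D] in auto)
  ultimately have "(\<lambda>n. vol (D n)) \<longlonglongrightarrow> 0" by (simp add: negligible_imp_measure0)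
  then have "\<forall>\<^sub>F n in sequentially. vol (D n) < e" using e by (rule order_tendstoD)
  then obtain n where "vol (D n) < e" using eventually_happens' by fastforce
  then show ?thesis unfolding D_def by (intro exI conjI) auto
qed

text \<open>The library computes the scaling factor as a determinant, but only for well-ordered index
  types; its existence is all that is needed.\<close>

lemma linear_scales_if_boxes:
  fixes f :: "real ^ 'd::finite \<Rightarrow> real ^ 'd"
  assumes f: "linear f" "\<And>a b. vol (f ` cbox a b) = m * vol (cbox a b)" and m: "0 \<le> m"
  shows "\<exists>\<mu>\<ge>0. \<forall>S\<in>lmeasurable. f ` S \<in> lmeasurable \<and> vol (f ` S) = \<mu> * vol S"
proof (rule exI[of _ m], intro conjI ballI m)
  fix S :: "(real ^ 'd) set" assume "S \<in> lmeasurable"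
  with f have "f ` S \<in> lmeasurable \<and> m * vol S = vol (f ` S)" by (intro measure_linear_sufficient)
  then show "f ` S \<in> lmeasurable" "vol (f ` S) = m * vol S" by simp_all
qed

text \<open>Scaling factors multiply under composition, so elementary maps suffice: singular maps
  have factor 0, while coordinate swaps and shears preserve the volume of boxes.\<close>

lemma linear_image_scales_vol:
  fixes f :: "real ^ 'd::finite \<Rightarrow> real ^ 'd"
  assumes "linear f"
  shows "\<exists>\<mu>\<ge>0. \<forall>S\<in>lmeasurable. f ` S \<in> lmeasurable \<and> vol (f ` S) = \<mu> * vol S"
    (is "?P f")
proof (rule induct_linear_elementary[of f ?P, OF assms])
  fix f g :: "real ^ 'd \<Rightarrow> real ^ 'd"
  assume "?P f" "?P g"
  then obtain a b where "a \<ge> 0" "\<forall>S\<in>lmeasurable. f ` S \<in> lmeasurable \<and> vol (f ` S) = a * vol S"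
    "b \<ge> 0" "\<forall>S\<in>lmeasurable. g ` S \<in> lmeasurable \<and> vol (g ` S) = b * vol S" by blast
  then show "?P (f \<circ> g)"
    unfolding image_comp[symmetric] by (intro exI[of _ "a * b"]) (simp del: image_image)
next
  fix f :: "real ^ 'd \<Rightarrow> real ^ 'd" and i
  assume "linear f" and 0: "\<And>x. f x $ i = 0"
  then have "\<not> inj f"
    by (metis (full_types) linear_injective_imp_surjective one_neq_zero surjE vec_component)
  then have "negligible (f ` S)" for S
    using \<open>linear f\<close> by (rule negligible_linear_singular_image[rotated])
  then show "?P f"
    by (intro exI[of _ 0]) (auto simp: negligible_imp_measurable negligible_imp_measure0)
next
  fix c :: "'d \<Rightarrow> real"
  show "?P (\<lambda>x. \<chi> i. c i * x $ i)"
    by (intro exI[of _ "\<bar>prod c UNIV\<bar>"]) (auto simp: measurable_stretch measure_stretch)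
next
  fix m n :: 'd assume "m \<noteq> n"
  let ?h = "\<lambda>x :: real ^ 'd. \<chi> i. x $ Transposition.transpose m n i"
  have lin: "linear ?h" by (rule linearI) (simp_all add: vec_eq_iff)
  have "vol (?h ` cbox a b) = 1 * vol (cbox a b)" for a b
  proof (cases "cbox a b = {}")
    case False
    have eq: "?h ` cbox a b = cbox (?h a) (?h b)"
      by (auto simp: image_iff lambda_swap_Galois mem_box_cart) (metis transpose_involutory)+
    have ne: "cbox (?h a) (?h b) \<noteq> {}" using False unfolding eq[symmetric] by blast
    have "vol (?h ` cbox a b) = (\<Prod>i\<in>UNIV. ?h b $ i - ?h a $ i)"
      unfolding eq using content_cbox_cart[OF ne] by simp
    also have "\<dots> = (\<Prod>i\<in>UNIV. b $ i - a $ i)"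
      using prod.permute[OF permutes_swap_id, where S = UNIV and g = "\<lambda>i. (b - a) $ i", of m n]
      by (simp add: comp_def)
    also have "\<dots> = vol (cbox a b)" using content_cbox_cart[OF False] by simp
    finally show ?thesis by simp
  next
    case True
    then show ?thesis by simp
  qed
  then show "?P ?h" by (intro linear_scales_if_boxes[of ?h 1] lin) auto
next
  fix m n :: 'd assume mn: "m \<noteq> n"
  let ?h = "\<lambda>x :: real ^ 'd. \<chi> i. if i = m then x $ m + x $ n else x $ i"
  have lin: "linear ?h" by (rule linearI) (auto simp: vec_eq_iff algebra_simps)
  have "vol (?h ` cbox a b) = 1 * vol (cbox a b)" for a b
  proof (cases "cbox a b = {}")
    case False
    \<comment> \<open>The shear formula is applied to a box with lower corner 0, where the
      coordinate being added is nonnegative.\<close>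
    have box: "cbox a b = (+) a ` cbox 0 (b - a)" by (simp flip: cbox_translation)
    have "?h ` cbox a b = (+) (?h a) ` ?h ` cbox 0 (b - a)"
      unfolding box by (auto simp: image_comp linear_add[OF lin, simplified] intro!: image_cong)
    then have "vol (?h ` cbox a b) = vol (?h ` cbox 0 (b - a))" by (simp only: measure_translation)
    also have "\<dots> = vol (cbox 0 (b - a))"
      using False box by (intro measure_shear_interval mn) auto
    also have "\<dots> = vol (cbox a b)" unfolding box by (simp only: measure_translation)
    finally show ?thesis by simp
  qed simp
  then show "?P ?h" by (intro linear_scales_if_boxes[of ?h 1] lin) auto
qed

section \<open>Families of sets with null overlaps\<close>

text \<open>Neighbouring tiles share boundary points, so disjointness is required only up to null
  sets. Indexing by \<open>s\<close> lets the tiles themselves be the indices, so that they keep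
  their types.\<close>

definition ae_disjoint :: "('a \<Rightarrow> (real ^ 'd::finite) set) \<Rightarrow> 'a set \<Rightarrow> bool" where
  "ae_disjoint s P \<longleftrightarrow> finite P \<and> (\<forall>U\<in>P. s U \<in> lmeasurable) \<and>
     pairwise (\<lambda>U V. negligible (s U \<inter> s V)) P"

lemma ae_disjoint_subset: "ae_disjoint s P \<Longrightarrow> Q \<subseteq> P \<Longrightarrow> ae_disjoint s Q"
  by (auto simp: ae_disjoint_def pairwise_def intro: finite_subset)

lemma ae_disjoint_UN_lmeasurable: "ae_disjoint s P \<Longrightarrow> (\<Union>U\<in>P. s U) \<in> lmeasurable"
  by (auto simp: ae_disjoint_def)

lemma vol_Int_UN:
  assumes P: "ae_disjoint s P" and B: "B \<in> lmeasurable"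
  shows "vol (B \<inter> (\<Union>U\<in>P. s U)) = (\<Sum>U\<in>P. vol (B \<inter> s U))"
proof -
  have "vol (\<Union>U\<in>P. B \<inter> s U) = (\<Sum>U\<in>P. vol (B \<inter> s U))"
  proof (rule measure_negligible_finite_Union_image)
    show "pairwise (\<lambda>U V. negligible (B \<inter> s U \<inter> (B \<inter> s V))) P"
      using P unfolding ae_disjoint_def pairwise_def by (auto elim!: negligible_subset ballE)
  qed (use P B in \<open>auto simp: ae_disjoint_def\<close>)
  then show ?thesis by simp
qed

lemma sum_vol_le:
  assumes P: "ae_disjoint s P" and sub: "\<And>U. U \<in> P \<Longrightarrow> s U \<subseteq> D" and D: "D \<in> lmeasurable"
  shows "(\<Sum>U\<in>P. vol (s U)) \<le> vol D"
proof -
  have "(\<Sum>U\<in>P. vol (s U)) = (\<Sum>U\<in>P. vol (D \<inter> s U))"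
    using sub by (intro sum.cong) (auto intro: arg_cong[where f = vol])
  also have "\<dots> = vol (D \<inter> (\<Union>U\<in>P. s U))" using vol_Int_UN[OF P D] by simp
  also have "\<dots> \<le> vol D"
    using D ae_disjoint_UN_lmeasurable[OF P] by (intro measure_mono_fmeasurable) auto
  finally show ?thesis .
qed

text \<open>Once \<open>P\<close> covers \<open>B\<close>, any other member of \<open>Q\<close>
  meets \<open>B\<close> in a null set, since it meets every member of \<open>P\<close> in
  one.\<close>

lemma vol_Int_UN_subfamily:
  assumes Q: "ae_disjoint s Q" and P: "P \<subseteq> Q" and B: "B \<in> lmeasurable" "B \<subseteq> (\<Union>U\<in>P. s U)"
  shows "vol (B \<inter> (\<Union>U\<in>Q \<inter> E. s U)) = vol (B \<inter> (\<Union>U\<in>P \<inter> E. s U))"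
proof -
  have null: "vol (B \<inter> s V) = 0" if "V \<in> Q - P" for V
  proof -
    have "negligible (\<Union>U\<in>P. s U \<inter> s V)"
      using that Q P by (intro negligible_Union) (auto simp: ae_disjoint_def pairwise_def intro: finite_subset)
    then have "negligible (B \<inter> s V)" by (rule negligible_subset) (use B in auto)
    then show ?thesis by (rule negligible_imp_measure0)
  qed
  have "vol (B \<inter> (\<Union>U\<in>Q \<inter> E. s U)) = (\<Sum>U\<in>Q \<inter> E. vol (B \<inter> s U))"
    by (rule vol_Int_UN[OF ae_disjoint_subset[OF Q] B(1)]) auto
  also have "\<dots> = (\<Sum>U\<in>P \<inter> E. vol (B \<inter> s U))"
    using Q P null by (intro sum.mono_neutral_right) (auto simp: ae_disjoint_def)
  also have "\<dots> = vol (B \<inter> (\<Union>U\<in>P \<inter> E. s U))"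
    by (rule vol_Int_UN[OF ae_disjoint_subset[OF Q] B(1), symmetric]) (use P in auto)
  finally show ?thesis .
qed

text \<open>Only the members of \<open>P\<close> that straddle the boundary of \<open>B\<close> contribute to the error: on the
  image of a member contained in \<open>B\<close> both sides agree, since there only its own family
  \<open>\<sigma> U\<close> is visible.\<close>

lemma vol_inflated_subfamily:
  fixes \<psi> :: "real ^ 'd::finite \<Rightarrow> real ^ 'd"
  assumes P: "ae_disjoint s P" and Q: "ae_disjoint s (\<Union>U\<in>P. \<sigma> U)"
    and B: "B \<in> lmeasurable" "B \<subseteq> (\<Union>U\<in>P. s U)" "bounded B"
    and diam: "\<And>U x y. U \<in> P \<Longrightarrow> x \<in> s U \<Longrightarrow> y \<in> s U \<Longrightarrow> dist x y < R"
    and \<psi>: "linear \<psi>" and \<psi>m: "\<And>S. S \<in> lmeasurable \<Longrightarrow> \<psi> ` S \<in> lmeasurable"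
      "\<And>S. S \<in> lmeasurable \<Longrightarrow> vol (\<psi> ` S) = \<mu> * vol S" and \<mu>: "0 \<le> \<mu>"
    and cov: "\<And>U. U \<in> P \<Longrightarrow> \<psi> ` s U \<subseteq> (\<Union>V\<in>\<sigma> U. s V)"
  shows "\<bar>vol (\<psi> ` B \<inter> (\<Union>V\<in>(\<Union>U\<in>P. \<sigma> U) \<inter> E. s V)) -
      (\<Sum>U\<in>P. vol (\<psi> ` s U \<inter> (\<Union>V\<in>\<sigma> U \<inter> E. s V)) / vol (s U) * vol (B \<inter> s U))\<bar>
    \<le> \<mu> * vol (thick_boundary R B)"
proof -
  \<comment> \<open>In the application \<psi> is the inflation \<open>\<phi> ^^ m\<close>, not its
    inverse, and \<open>E\<close> selects one tile type.\<close>
  define F where "F = (\<Union>V\<in>(\<Union>U\<in>P. \<sigma> U) \<inter> E. s V)"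
  \<comment> \<open>The predicted contribution of \<open>U\<close>: the selected volume in the image
    of \<open>s U\<close>, reduced in proportion to the part of \<open>s U\<close> lying in
    \<open>B\<close>.\<close>
  define h where "h U = vol (\<psi> ` s U \<inter> (\<Union>V\<in>\<sigma> U \<inter> E. s V)) / vol (s U) * vol (B \<inter> s U)" for U
  have fin: "finite P" and s: "\<And>U. U \<in> P \<Longrightarrow> s U \<in> lmeasurable"
    using P by (auto simp: ae_disjoint_def)
  have F: "F \<in> lmeasurable"
    unfolding F_def by (rule ae_disjoint_UN_lmeasurable[OF ae_disjoint_subset[OF Q]]) auto
  have vol_le: "vol (\<psi> ` S \<inter> X) \<le> \<mu> * vol S" if "S \<in> lmeasurable" "X \<in> lmeasurable" for S X
    using measure_mono_fmeasurable[of "\<psi> ` S \<inter> X" "\<psi> ` S" lebesgue] \<psi>m[OF that(1)] that by auto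
  have loc: "vol (C \<inter> F) = vol (C \<inter> (\<Union>V\<in>\<sigma> U \<inter> E. s V))"
    if "U \<in> P" "C \<in> lmeasurable" "C \<subseteq> \<psi> ` s U" for U C
    unfolding F_def using that cov[OF that(1)] by (intro vol_Int_UN_subfamily[OF Q]) auto
  have "vol (\<psi> ` B \<inter> F) = vol (\<Union>U\<in>P. \<psi> ` (B \<inter> s U) \<inter> F)"
    using B by (intro arg_cong[where f = vol]) blast
  also have "\<dots> = (\<Sum>U\<in>P. vol (\<psi> ` (B \<inter> s U) \<inter> F))"
  proof (rule measure_negligible_finite_Union_image[OF fin])
    show "\<psi> ` (B \<inter> s U) \<inter> F \<in> lmeasurable" if "U \<in> P" for U
      using that s B F by (intro fmeasurable.Int \<psi>m) auto
    show "pairwise (\<lambda>U V. negligible (\<psi> ` (B \<inter> s U) \<inter> F \<inter> (\<psi> ` (B \<inter> s V) \<inter> F))) P"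
    proof (rule pairwiseI)
      fix U V assume UV: "U \<in> P" "V \<in> P" "U \<noteq> V"
      show "negligible (\<psi> ` (B \<inter> s U) \<inter> F \<inter> (\<psi> ` (B \<inter> s V) \<inter> F))"
      \<comment> \<open>Either \<psi> is injective and carries the null overlap along, or all its
        images are null.\<close>
      proof (cases "inj \<psi>")
        case True
        have "negligible (s U \<inter> s V)" using P UV by (auto simp: ae_disjoint_def pairwise_def)
        then have "negligible (\<psi> ` (s U \<inter> s V))"
          using \<psi>m[of "s U \<inter> s V"] by (simp add: negligible_iff_measure)
        then show ?thesis by (rule negligible_subset) (use True in \<open>auto dest: injD\<close>)
      next
        case False
        then have "negligible (\<psi> ` (B \<inter> s U))" by (intro negligible_linear_singular_image \<psi>)
        then show ?thesis by (rule negligible_subset) auto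
      qed
    qed
  qed
  finally have eq: "vol (\<psi> ` B \<inter> F) - (\<Sum>U\<in>P. h U) = (\<Sum>U\<in>P. vol (\<psi> ` (B \<inter> s U) \<inter> F) - h U)"
    by (simp add: sum_subtractf)
  define P' where "P' = {U \<in> P. s U \<inter> B \<noteq> {} \<and> \<not> s U \<subseteq> B}"
  have h: "0 \<le> h U" "h U \<le> \<mu> * vol (B \<inter> s U)" if "U \<in> P" for U
  proof -
    have "(\<Union>V\<in>\<sigma> U \<inter> E. s V) \<in> lmeasurable"
      by (rule ae_disjoint_UN_lmeasurable[OF ae_disjoint_subset[OF Q]]) (use that in auto)
    from vol_le[OF s[OF that] this]
    have "vol (\<psi> ` s U \<inter> (\<Union>V\<in>\<sigma> U \<inter> E. s V)) / vol (s U) \<le> \<mu>"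
      using \<mu> measure_nonneg[of lebesgue "s U"] by (cases "vol (s U) = 0") (auto simp: divide_le_eq)
    then show "h U \<le> \<mu> * vol (B \<inter> s U)" unfolding h_def by (intro mult_right_mono) auto
  qed (simp add: h_def)
  \<comment> \<open>For a straddling member the actual and the predicted volume both lie between 0
    and \<open>\<mu> * vol (s U)\<close>, hence differ by no more than that.\<close>
  have bnd: "\<bar>vol (\<psi> ` (B \<inter> s U) \<inter> F) - h U\<bar> \<le> (if U \<in> P' then \<mu> * vol (s U) else 0)"
    if U: "U \<in> P" for U
  proof (cases "U \<in> P'")
    case True
    have m: "B \<inter> s U \<in> lmeasurable" using B s U by auto
    have "\<mu> * vol (B \<inter> s U) \<le> \<mu> * vol (s U)"
      using s[OF U] m by (intro mult_left_mono measure_mono_fmeasurable) (auto simp: \<mu>)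
    moreover have "vol (\<psi> ` (B \<inter> s U) \<inter> F) \<le> \<mu> * vol (B \<inter> s U)" by (rule vol_le[OF m F])
    ultimately have "\<bar>vol (\<psi> ` (B \<inter> s U) \<inter> F) - h U\<bar> \<le> \<mu> * vol (s U)"
      using h[OF U] measure_nonneg[of lebesgue "\<psi> ` (B \<inter> s U) \<inter> F"] by linarith
    then show ?thesis using True by simp
  next
    case False
    then consider "B \<inter> s U = {}" | "B \<inter> s U = s U" using U by (auto simp: P'_def)
    then show ?thesis
    proof cases
      case 1
      then show ?thesis by (simp add: h_def \<mu>)
    next
      case 2
      have eq: "vol (\<psi> ` s U \<inter> F) = vol (\<psi> ` s U \<inter> (\<Union>V\<in>\<sigma> U \<inter> E. s V))"
        by (rule loc[OF U \<psi>m(1)[OF s[OF U]] order_refl])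
      show ?thesis
      \<comment> \<open>For a null \<open>s U\<close> the quotient in \<open>h U\<close> is 0 by
        convention, in agreement with the null image.\<close>
      proof (cases "vol (s U) = 0")
        case True
        then have "vol (\<psi> ` s U \<inter> F) = 0"
          using vol_le[OF s[OF U] F] measure_nonneg[of lebesgue "\<psi> ` s U \<inter> F"] by simp
        then show ?thesis using 2 True by (simp add: h_def \<mu>)
      qed (use 2 eq in \<open>simp add: h_def \<mu>\<close>)
    qed
  qed
  have "\<bar>vol (\<psi> ` B \<inter> F) - (\<Sum>U\<in>P. h U)\<bar> \<le> (\<Sum>U\<in>P. if U \<in> P' then \<mu> * vol (s U) else 0)"
    unfolding eq by (rule order_trans[OF sum_abs sum_mono[OF bnd]])
  also have "\<dots> = \<mu> * (\<Sum>U\<in>P'. vol (s U))"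
    unfolding sum_distrib_left using fin
    by (intro sum.mono_neutral_cong_right) (auto simp: P'_def)
  also have "\<dots> \<le> \<mu> * vol (thick_boundary R B)"
  proof (intro mult_left_mono sum_vol_le)
    show "ae_disjoint s P'" by (rule ae_disjoint_subset[OF P]) (auto simp: P'_def)
    show "s U \<subseteq> thick_boundary R B" if "U \<in> P'" for U
      using that diam by (intro subset_thick_boundary) (auto simp: P'_def)
  qed (auto simp: \<mu> lmeasurable_thick_boundary B)
  finally show ?thesis unfolding F_def h_def .
qed

subsection \<open>Supertiles\<close>

lemma translate_tile_0 [simp]: "translate_tile 0 U = U"
  by (cases U) auto

lemma translate_tile_add [simp]: "translate_tile x (translate_tile y U) = translate_tile (x + y) U"
  by (cases U) (auto simp: image_image add.assoc)

lemma supp_translate_tile [simp]: "supp (translate_tile x U) = (+) x ` supp U"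
  by (cases U) auto

text \<open>A nonempty compact set is not invariant under a nonzero translation: a point maximal in
  the direction \<open>x - y\<close> would be moved further in that direction.\<close>

lemma translate_tile_vec_inject:
  assumes "is_tile U" "translate_tile x U = translate_tile y U"
  shows "x = y"
proof -
  have U: "compact (supp U)" "supp U \<noteq> {}" using assms(1) unfolding is_tile_def by blast+
  have "continuous_on (supp U) (\<lambda>u. u \<bullet> (x - y))" by (intro continuous_intros)
  from continuous_attains_sup[OF U this]
  obtain s where s: "s \<in> supp U" "\<And>u. u \<in> supp U \<Longrightarrow> u \<bullet> (x - y) \<le> s \<bullet> (x - y)" by blast
  have "(+) x ` supp U = (+) y ` supp U" using assms(2) by (metis supp_translate_tile)
  then obtain u where "u \<in> supp U" "x + s = y + u" using s(1) by blast
  then have "u = s + (x - y)" "u \<in> supp U" by (auto simp: algebra_simps)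
  then have "(x - y) \<bullet> (x - y) \<le> 0" using s(2)[of u] by (simp add: inner_add_left)
  then have "(x - y) \<bullet> (x - y) = 0" using inner_ge_zero[of "x - y"] by linarith
  then show ?thesis by simp
qed

lemma is_patch_subset: "is_patch P \<Longrightarrow> Q \<subseteq> P \<Longrightarrow> is_patch Q"
  unfolding is_patch_def by blast

text \<open>A null set has empty interior, so a null tile would be the closure of the empty
  set.\<close>

lemma vol_supp_pos:
  assumes "is_tile U"
  shows "0 < vol (supp U)"
proof (rule ccontr)
  have c: "compact (supp U)" "supp U \<noteq> {}" "supp U = closure (interior (supp U))" using assms unfolding is_tile_def by blast+
  assume "\<not> 0 < vol (supp U)"
  then have "vol (supp U) = 0" using measure_nonneg[of lebesgue "supp U"] by linarith
  then have "negligible (supp U)" using lmeasurable_compact[OF c(1)] by (simp add: negligible_iff_measure)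
  then have int: "interior (supp U) = {}"
    using open_not_negligible[OF open_interior] negligible_subset[OF _ interior_subset] by blast
  have "supp U = {}" using c(3) unfolding int closure_empty .
  with c(2) show False by simp
qed

text \<open>The spectral hypothesis on \<phi> is replaced by its geometric consequences: a
  contracting inverse \<psi> and a volume factor \<mu>, which is the absolute value of the
  determinant.\<close>

locale inflation_substitution =
  fixes T :: "'k::finite \<Rightarrow> ('d::finite, 'l) tile" and \<phi> \<psi> :: "real ^ 'd \<Rightarrow> real ^ 'd"
    and \<rho> :: "'k \<Rightarrow> ('d, 'l) tile set" and \<mu> :: real
  assumes subst: "overlapping_substitution T \<phi> \<rho>"
    and expand: "expanding T \<phi> \<rho>"
    and null_frontier: "\<And>i. negligible (frontier (supp (T i)))"
    and \<psi>_linear: "linear \<psi>" and \<phi>_\<psi>: "\<And>x. \<phi> (\<psi> x) = x" and \<psi>_\<phi>: "\<And>x. \<psi> (\<phi> x) = x"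
    and \<psi>_contracts: "\<And>e. 0 < e \<Longrightarrow> \<forall>\<^sub>F m in sequentially. \<forall>v. norm ((\<psi> ^^ m) v) \<le> e * norm v"
    and \<mu>: "0 < \<mu>" "\<And>S. S \<in> lmeasurable \<Longrightarrow> \<phi> ` S \<in> lmeasurable \<and> vol (\<phi> ` S) = \<mu> * vol S"
begin

abbreviation S :: "('d, 'l) tile set \<Rightarrow> ('d, 'l) tile set" where
  "S \<equiv> subst_pattern T \<phi> \<rho>"

abbreviation kind :: "'k \<Rightarrow> ('d, 'l) tile set" where
  "kind i \<equiv> range (\<lambda>x. translate_tile x (T i))"

abbreviation l :: "'k \<Rightarrow> real" where
  "l i \<equiv> vol (supp (T i))"

lemma pre_subst: "pre_overlapping_substitution T \<phi> \<rho>"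
  by (rule subst[unfolded overlapping_substitution_def, THEN conjunct1])

lemma tile_T: "is_tile (T i)"
  using pre_subst unfolding pre_overlapping_substitution_def by simp

lemma \<phi>_linear: "linear \<phi>"
  using pre_subst unfolding pre_overlapping_substitution_def by simp

lemma \<rho>: "finite (\<rho> i)" "\<rho> i \<subseteq> translates_of T"
  using pre_subst unfolding pre_overlapping_substitution_def by simp_all

lemma patch_iterate: "is_patch ((S ^^ n) {T i})"
proof (cases "n = 0")
  case True
  then show ?thesis using tile_T by (simp add: is_patch_def)
next
  case False
  then show ?thesis
    using subst[unfolded overlapping_substitution_def, THEN conjunct2] by simp
qed

lemma compact_T: "compact (supp (T i))"
  using tile_T unfolding is_tile_def by blast

lemma l_pos: "0 < l i"
  by (rule vol_supp_pos[OF tile_T])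

text \<open>Makes the substitution single-valued on translates, and makes counting position vectors
  the same as counting tiles.\<close>

lemma translate_tile_T_inject:
  assumes "translate_tile x (T i) = translate_tile y (T j)"
  shows "i = j \<and> x = y"
proof -
  have "T i = translate_tile (- x + y) (T j)"
    using arg_cong[OF assms, of "translate_tile (- x)"] by simp
  then have "i = j"
    using subst unfolding overlapping_substitution_def pre_overlapping_substitution_def by blast
  then show ?thesis using assms translate_tile_vec_inject[OF tile_T] by blast
qed

lemma translates_of_eq: "translates_of T = (\<Union>i. kind i)"
  by (auto simp: translates_of_def)

lemma translates_ofE:
  assumes "U \<in> translates_of T"
  obtains x i where "U = translate_tile x (T i)"
  using assms by (auto simp: translates_of_def)

lemma translate_in_translates: "U \<in> translates_of T \<Longrightarrow> translate_tile x U \<in> translates_of T"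
  by (force simp: translates_of_def)

lemma translate_tile_kind_iff: "translate_tile x U \<in> kind i \<longleftrightarrow> U \<in> kind i"
proof
  assume "translate_tile x U \<in> kind i"
  then obtain y where "translate_tile x U = translate_tile y (T i)" by auto
  from arg_cong[OF this, of "translate_tile (- x)"] show "U \<in> kind i" by auto
qed auto

lemma subst_tile_translate: "subst_tile T \<phi> \<rho> (translate_tile x (T i)) = translate_tile (\<phi> x) ` \<rho> i"
  unfolding subst_tile_def by (auto dest!: translate_tile_T_inject)

lemma S_UN: "S P = (\<Union>U\<in>P. S {U})"
  by (auto simp: subst_pattern_def)

lemma S_pow_UN: "(S ^^ n) P = (\<Union>U\<in>P. (S ^^ n) {U})"
proof (induction n)
  case (Suc n)
  have "(S ^^ Suc n) P = (\<Union>U\<in>(S ^^ n) P. S {U})" by (simp flip: S_UN)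
  also have "\<dots> = (\<Union>U\<in>P. \<Union>V\<in>(S ^^ n) {U}. S {V})" by (subst Suc) blast
  finally show ?case by (simp flip: S_UN)
qed simp

lemma S_pow_mono: "P \<subseteq> Q \<Longrightarrow> (S ^^ n) P \<subseteq> (S ^^ n) Q"
  unfolding S_pow_UN[of n P] S_pow_UN[of n Q] by blast

lemma S_step:
  assumes P: "P \<subseteq> translates_of T"
  shows "S P \<subseteq> translates_of T" "finite P \<Longrightarrow> finite (S P)"
    "S (translate_tile x ` P) = translate_tile (\<phi> x) ` S P"
    "\<phi> ` pattern_supp P \<subseteq> pattern_supp (S P)"
proof -
  have single: "S {U} \<subseteq> translates_of T \<and> finite (S {U}) \<and>
      S {translate_tile x U} = translate_tile (\<phi> x) ` S {U} \<and>
      \<phi> ` supp U \<subseteq> pattern_supp (S {U})" if "U \<in> P" for U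
  proof -
    have "U \<in> translates_of T" using that P by blast
    then obtain y i where U: "U = translate_tile y (T i)" by (rule translates_ofE)
    have S: "S {translate_tile z (T i)} = translate_tile (\<phi> z) ` \<rho> i" for z
      by (simp add: subst_pattern_def subst_tile_translate)
    have "\<phi> ` supp U = (+) (\<phi> y) ` \<phi> ` supp (T i)"
      by (simp add: U image_image linear_add[OF \<phi>_linear])
    also have "\<dots> \<subseteq> (+) (\<phi> y) ` pattern_supp (\<rho> i)"
      using expand unfolding expanding_def by blast
    also have "\<dots> = pattern_supp (S {U})" by (auto simp: U S pattern_supp_def)
    finally show ?thesis
      using \<rho>[of i] translate_in_translates
      by (auto simp: U S image_image linear_add[OF \<phi>_linear])
  qed
  have SP: "S P = (\<Union>U\<in>P. S {U})" by (rule S_UN)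
  show "S P \<subseteq> translates_of T" unfolding SP using single by blast
  show "finite P \<Longrightarrow> finite (S P)" unfolding SP using single by blast
  have "S (translate_tile x ` P) = (\<Union>U\<in>P. S {translate_tile x U})" by (subst S_UN) simp
  also have "\<dots> = (\<Union>U\<in>P. translate_tile (\<phi> x) ` S {U})"
    using single by (intro SUP_cong refl) blast
  also have "\<dots> = translate_tile (\<phi> x) ` S P" by (simp only: SP image_UN)
  finally show "S (translate_tile x ` P) = translate_tile (\<phi> x) ` S P" .
  have "\<phi> ` pattern_supp P \<subseteq> (\<Union>U\<in>P. pattern_supp (S {U}))"
    unfolding pattern_supp_def[of P] image_UN using single by (intro UN_mono order_refl) blast
  also have "\<dots> = pattern_supp (S P)" unfolding SP by (auto simp: pattern_supp_def)
  finally show "\<phi> ` pattern_supp P \<subseteq> pattern_supp (S P)" .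
qed

lemma S_pow:
  assumes P: "P \<subseteq> translates_of T"
  shows "(S ^^ n) P \<subseteq> translates_of T" "finite P \<Longrightarrow> finite ((S ^^ n) P)"
    "(S ^^ n) (translate_tile x ` P) = translate_tile ((\<phi> ^^ n) x) ` (S ^^ n) P"
    "(\<phi> ^^ n) ` pattern_supp P \<subseteq> pattern_supp ((S ^^ n) P)"
proof -
  show sub: "(S ^^ n) P \<subseteq> translates_of T" for n
    using P by (induction n) (auto dest: S_step(1))
  show "finite P \<Longrightarrow> finite ((S ^^ n) P)"
    by (induction n) (auto intro: S_step(2)[OF sub])
  show "(S ^^ n) (translate_tile x ` P) = translate_tile ((\<phi> ^^ n) x) ` (S ^^ n) P"
    by (induction n) (auto simp: S_step(3)[OF sub])
  show "(\<phi> ^^ n) ` pattern_supp P \<subseteq> pattern_supp ((S ^^ n) P)"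
  proof (induction n)
    case (Suc n)
    have "(\<phi> ^^ Suc n) ` pattern_supp P = \<phi> ` (\<phi> ^^ n) ` pattern_supp P" by (simp add: image_image)
    also have "\<dots> \<subseteq> \<phi> ` pattern_supp ((S ^^ n) P)" using Suc by (rule image_mono)
    also have "\<dots> \<subseteq> pattern_supp ((S ^^ Suc n) P)" using S_step(4)[OF sub[of n]] by simp
    finally show ?case .
  qed simp
qed

lemma \<phi>_pow:
  shows "linear (\<phi> ^^ m)" "(\<phi> ^^ m) ((\<psi> ^^ m) x) = x" "(\<psi> ^^ m) ((\<phi> ^^ m) x) = x" "linear (\<psi> ^^ m)"
    "A \<in> lmeasurable \<Longrightarrow> (\<phi> ^^ m) ` A \<in> lmeasurable"
    "A \<in> lmeasurable \<Longrightarrow> vol ((\<phi> ^^ m) ` A) = \<mu> ^ m * vol A"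
proof -
  show "linear (\<phi> ^^ m)" "linear (\<psi> ^^ m)"
    using linear_compose[OF _ \<phi>_linear] linear_compose[OF _ \<psi>_linear] linear_id
    by (induction m) (auto simp: comp_def id_def)
  show "(\<phi> ^^ m) ((\<psi> ^^ m) x) = x" for x
  proof (induction m)
    case (Suc m)
    have "(\<phi> ^^ Suc m) ((\<psi> ^^ Suc m) x) = (\<phi> ^^ m) (\<phi> (\<psi> ((\<psi> ^^ m) x)))"
      by (simp add: funpow_swap1)
    then show ?case using Suc by (simp add: \<phi>_\<psi>)
  qed simp
  show "(\<psi> ^^ m) ((\<phi> ^^ m) x) = x" for x
  proof (induction m)
    case (Suc m)
    have "(\<psi> ^^ Suc m) ((\<phi> ^^ Suc m) x) = (\<psi> ^^ m) (\<psi> (\<phi> ((\<phi> ^^ m) x)))"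
      by (simp add: funpow_swap1)
    then show ?case using Suc by (simp add: \<psi>_\<phi>)
  qed simp
  have "A \<in> lmeasurable \<Longrightarrow> (\<phi> ^^ m) ` A \<in> lmeasurable \<and> vol ((\<phi> ^^ m) ` A) = \<mu> ^ m * vol A"
  proof (induction m)
    case (Suc m)
    have "(\<phi> ^^ Suc m) ` A = \<phi> ` (\<phi> ^^ m) ` A" by (simp add: image_image)
    then show ?case using \<mu>(2)[of "(\<phi> ^^ m) ` A"] Suc by simp
  qed simp
  then show "A \<in> lmeasurable \<Longrightarrow> (\<phi> ^^ m) ` A \<in> lmeasurable"
    "A \<in> lmeasurable \<Longrightarrow> vol ((\<phi> ^^ m) ` A) = \<mu> ^ m * vol A" by auto
qed

lemma supp_compact: "U \<in> translates_of T \<Longrightarrow> compact (supp U)"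
  using compact_T by (auto elim!: translates_ofE intro!: compact_continuous_image continuous_intros)

lemma negligible_frontier: "U \<in> translates_of T \<Longrightarrow> negligible (frontier (supp U))"
  by (auto elim!: translates_ofE simp: frontier_translation intro!: negligible_translation null_frontier)

text \<open>Closed sets with disjoint interiors meet inside the union of their frontiers. This is
  where null frontiers turn the patch condition into additivity of volumes.\<close>

lemma ae_disjoint_patch:
  assumes "finite P" "is_patch P" "P \<subseteq> translates_of T"
  shows "ae_disjoint supp P"
  unfolding ae_disjoint_def
proof (intro conjI ballI pairwiseI)
  show "supp U \<in> lmeasurable" if "U \<in> P" for U
    using that assms supp_compact by (auto intro: lmeasurable_compact)
  fix U V assume UV: "U \<in> P" "V \<in> P" "U \<noteq> V"
  have "interior (supp U) \<inter> interior (supp V) = {}"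
    using UV assms(2) by (auto simp: is_patch_def)
  moreover have "closed (supp U)" "closed (supp V)"
    using UV assms supp_compact by (auto intro: compact_imp_closed)
  ultimately have "supp U \<inter> supp V \<subseteq> frontier (supp U) \<union> frontier (supp V)"
    by (auto simp: frontier_def)
  then show "negligible (supp U \<inter> supp V)"
    using UV assms negligible_frontier by (meson negligible_Un negligible_subset subsetD)
qed (rule assms)

lemma ex_diameter_bound: "\<exists>R>0. \<forall>i. supp (T i) \<subseteq> ball 0 (R / 2)"
proof -
  have "bounded (\<Union>i. supp (T i))" by (intro bounded_UN ballI compact_imp_bounded compact_T) simp
  then obtain B where "B > 0" "\<And>x. x \<in> (\<Union>i. supp (T i)) \<Longrightarrow> norm x \<le> B"
    unfolding bounded_pos by blast
  then show ?thesis by (intro exI[of _ "2 * (B + 1)"]) force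
qed

text \<open>A proto-tile need not contain the origin, so a tile need not contain its position
  vector. Placing all proto-tiles in a ball around 0 bounds the diameters and the distance from a
  tile to its position vector together.\<close>

definition R :: real where
  "R = (SOME R. 0 < R \<and> (\<forall>i. supp (T i) \<subseteq> ball 0 (R / 2)))"

lemma R: "0 < R" "x \<in> supp (T i) \<Longrightarrow> norm x < R / 2"
  using someI_ex[OF ex_diameter_bound] unfolding R_def[symmetric] by (auto dest!: spec[of _ i])

lemma dist_less_R:
  assumes "x \<in> insert y (supp (translate_tile y (T i)))" "z \<in> insert y (supp (translate_tile y (T i)))"
  shows "dist x z < R"
proof -
  have "norm (x - y) < R / 2" "norm (z - y) < R / 2" using assms R by auto
  then show ?thesis using norm_triangle_ineq4[of "x - y" "z - y"] by (simp add: dist_norm)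
qed

text \<open>A packing argument: tiles meeting \<open>D\<close> lie in a fixed ball, overlap in null
  sets, and have volumes bounded below.\<close>

lemma locally_finite:
  assumes P: "is_patch P" "P \<subseteq> translates_of T" and D: "bounded D"
  shows "finite {U \<in> P. supp U \<inter> D \<noteq> {}}"
proof (rule ccontr)
  assume inf: "infinite {U \<in> P. supp U \<inter> D \<noteq> {}}"
  obtain B where B: "\<And>x. x \<in> D \<Longrightarrow> norm x \<le> B" using D by (auto simp: bounded_iff)
  define \<delta> where "\<delta> = Min (range l)"
  have \<delta>: "0 < \<delta>" "\<And>i. \<delta> \<le> l i" using l_pos by (auto simp: \<delta>_def)
  obtain n where n: "vol (ball (0 :: real ^ 'd) (B + R)) < real n * \<delta>"
    using reals_Archimedean3[OF \<delta>(1)] by blast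
  obtain F where F: "F \<subseteq> {U \<in> P. supp U \<inter> D \<noteq> {}}" "finite F" "card F = n"
    using infinite_arbitrarily_large[OF inf] by blast
  have trans: "U \<in> translates_of T" if "U \<in> F" for U using that F P by blast
  have "real n * \<delta> \<le> (\<Sum>U\<in>F. vol (supp U))"
    unfolding F(3)[symmetric]
    by (rule sum_bounded_below) (use trans \<delta> in \<open>force simp: translates_of_def measure_translation\<close>)
  also have "\<dots> \<le> vol (ball (0 :: real ^ 'd) (B + R))"
  proof (rule sum_vol_le)
    show "ae_disjoint supp F"
      using F P by (intro ae_disjoint_patch is_patch_subset[OF P(1)]) auto
    fix U assume U: "U \<in> F"
    then obtain y i where Uy: "U = translate_tile y (T i)" using trans translates_ofE by meson
    obtain d where d: "d \<in> supp U" "d \<in> D" using U F by auto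
    show "supp U \<subseteq> ball 0 (B + R)"
    proof
      fix x assume "x \<in> supp U"
      then have "dist x d < R" using d unfolding Uy by (intro dist_less_R) auto
      then show "x \<in> ball 0 (B + R)"
        using B[OF d(2)] norm_triangle_ineq2[of x d] by (auto simp: dist_norm)
    qed
  qed simp
  finally show False using n by simp
qed

lemma sum_kinds:
  assumes "finite P" "P \<subseteq> translates_of T"
  shows "(\<Sum>j\<in>UNIV. \<Sum>U\<in>P \<inter> kind j. f U) = (\<Sum>U\<in>P. f U)"
proof -
  have "P = (\<Union>j. P \<inter> kind j)" using assms(2) by (auto simp: translates_of_eq)
  moreover have "(\<Sum>U\<in>(\<Union>j. P \<inter> kind j). f U) = (\<Sum>j\<in>UNIV. \<Sum>U\<in>P \<inter> kind j. f U)"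
    using assms(1) by (intro sum.UNION_disjoint) (auto dest: translate_tile_T_inject)
  ultimately show ?thesis by simp
qed

section \<open>Proportions of tile types in supertiles\<close>

definition covol :: "'k \<Rightarrow> ('d, 'l) tile set \<Rightarrow> (real ^ 'd) set \<Rightarrow> real" where
  "covol i P B = vol (B \<inter> (\<Union>U\<in>P \<inter> kind i. supp U))"

lemma covol_eq_sum:
  assumes "finite P" "is_patch P" "P \<subseteq> translates_of T" "B \<in> lmeasurable"
  shows "covol i P B = (\<Sum>U\<in>P \<inter> kind i. vol (B \<inter> supp U))"
  unfolding covol_def using assms
  by (intro vol_Int_UN ae_disjoint_subset[OF ae_disjoint_patch[of P]]) auto

lemma sum_covol:
  assumes P: "finite P" "is_patch P" "P \<subseteq> translates_of T" and B: "B \<in> lmeasurable" "B \<subseteq> pattern_supp P"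
  shows "(\<Sum>i\<in>UNIV. covol i P B) = vol B"
proof -
  have "(\<Sum>i\<in>UNIV. covol i P B) = (\<Sum>U\<in>P. vol (B \<inter> supp U))"
    using P B by (simp add: covol_eq_sum sum_kinds)
  also have "\<dots> = vol (B \<inter> (\<Union>U\<in>P. supp U))"
    using vol_Int_UN[OF ae_disjoint_patch[OF P] B(1)] by simp
  also have "B \<inter> (\<Union>U\<in>P. supp U) = B" using B(2) by (auto simp: pattern_supp_def)
  finally show ?thesis .
qed

text \<open>Only the part of the supertile inside the inflated support is measured. This makes the
  proportions sum to 1 over \<open>i\<close> and agrees with the truncation in the substitution
  matrix.\<close>

definition dens :: "nat \<Rightarrow> 'k \<Rightarrow> 'k \<Rightarrow> real" where
  "dens m i j = covol i ((S ^^ m) {T j}) ((\<phi> ^^ m) ` supp (T j)) / (\<mu> ^ m * l j)"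

lemma covol_supertile: "covol i ((S ^^ m) {T j}) ((\<phi> ^^ m) ` supp (T j)) = \<mu> ^ m * l j * dens m i j"
  using \<mu>(1) l_pos[of j] by (simp add: dens_def)

lemma T_translates: "{T j} \<subseteq> translates_of T"
  by (auto simp: translates_of_def intro!: exI[of _ 0] exI[of _ j])

lemma supp_T_lmeasurable: "supp (T j) \<in> lmeasurable"
  using supp_compact T_translates by (auto intro: lmeasurable_compact)

lemma dens_nonneg: "0 \<le> dens m i j"
  using \<mu>(1) by (simp add: dens_def covol_def)

lemma sum_dens: "(\<Sum>i\<in>UNIV. dens m i j) = 1"
proof -
  have "(\<Sum>i\<in>UNIV. covol i ((S ^^ m) {T j}) ((\<phi> ^^ m) ` supp (T j))) = vol ((\<phi> ^^ m) ` supp (T j))"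
    using S_pow(4)[OF T_translates[of j], of m]
    by (intro sum_covol S_pow T_translates patch_iterate \<phi>_pow supp_T_lmeasurable)
      (auto simp: pattern_supp_def)
  also have "\<dots> = \<mu> ^ m * l j" by (rule \<phi>_pow(6)[OF supp_T_lmeasurable])
  finally show ?thesis
    using \<mu>(1) l_pos[of j] by (simp add: dens_def flip: sum_divide_distrib)
qed

text \<open>Translating a tile by \<open>x\<close> translates its supertile by
  \<open>(\<phi> ^^ m) x\<close>, so the proportions depend only on the type.\<close>

lemma covol_translated_supertile:
  assumes "U = translate_tile x (T j)"
  shows "covol i ((S ^^ m) {U}) ((\<phi> ^^ m) ` supp U) = \<mu> ^ m * dens m i j * vol (supp U)"
proof -
  define v where "v = (\<phi> ^^ m) x"
  define P where "P = (S ^^ m) {T j}"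
  have "(S ^^ m) {U} = translate_tile v ` P"
    using S_pow(3)[OF T_translates, of m x j] by (simp add: assms v_def P_def)
  moreover have "translate_tile v ` P \<inter> K = translate_tile v ` (P \<inter> K)"
    if "\<And>V. translate_tile v V \<in> K \<longleftrightarrow> V \<in> K" for K
    using that by blast
  ultimately have "(S ^^ m) {U} \<inter> kind i = translate_tile v ` (P \<inter> kind i)"
    using translate_tile_kind_iff by simp
  then have "(\<Union>V\<in>(S ^^ m) {U} \<inter> kind i. supp V) = (+) v ` (\<Union>V\<in>P \<inter> kind i. supp V)"
    by (auto simp: image_UN)
  moreover have "(\<phi> ^^ m) ` supp U = (+) v ` (\<phi> ^^ m) ` supp (T j)"
    by (simp add: assms v_def image_image linear_add[OF \<phi>_pow(1)])
  ultimately have "covol i ((S ^^ m) {U}) ((\<phi> ^^ m) ` supp U)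
      = vol ((+) v ` ((\<phi> ^^ m) ` supp (T j) \<inter> (\<Union>V\<in>P \<inter> kind i. supp V)))"
    by (simp add: covol_def image_Int)
  also have "\<dots> = \<mu> ^ m * l j * dens m i j"
    unfolding measure_translation P_def using covol_supertile by (simp add: covol_def)
  finally show ?thesis by (simp add: assms measure_translation)
qed

text \<open>The predicted proportion for a tile depends only on its type; grouping tiles by type
  turns the prediction into the matrix \<open>dens m\<close> applied to the vector of covered
  volumes.\<close>

lemma covol_inflate:
  assumes P: "finite P" "is_patch P" "P \<subseteq> translates_of T" "is_patch ((S ^^ m) P)"
    and B: "B \<in> lmeasurable" "bounded B" "B \<subseteq> pattern_supp P"
  shows "\<bar>covol i ((S ^^ m) P) ((\<phi> ^^ m) ` B) - \<mu> ^ m * (\<Sum>j\<in>UNIV. dens m i j * covol j P B)\<bar>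
    \<le> \<mu> ^ m * vol (thick_boundary R B)"
proof -
  have sub: "{U} \<subseteq> translates_of T" if "U \<in> P" for U using that P by auto
  have "\<bar>vol ((\<phi> ^^ m) ` B \<inter> (\<Union>V\<in>(\<Union>U\<in>P. (S ^^ m) {U}) \<inter> kind i. supp V)) -
      (\<Sum>U\<in>P. vol ((\<phi> ^^ m) ` supp U \<inter> (\<Union>V\<in>(S ^^ m) {U} \<inter> kind i. supp V)) / vol (supp U)
         * vol (B \<inter> supp U))\<bar>
    \<le> \<mu> ^ m * vol (thick_boundary R B)"
  proof (rule vol_inflated_subfamily)
    show "ae_disjoint supp P" by (rule ae_disjoint_patch[OF P(1-3)])
    show "ae_disjoint supp (\<Union>U\<in>P. (S ^^ m) {U})"
      unfolding S_pow_UN[of m P, symmetric] using P by (intro ae_disjoint_patch S_pow)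
    show "dist x y < R" if "U \<in> P" "x \<in> supp U" "y \<in> supp U" for U x y
    proof -
      have "U \<in> translates_of T" using that P by blast
      then obtain z j where "U = translate_tile z (T j)" by (rule translates_ofE)
      then show ?thesis using that by (intro dist_less_R) auto
    qed
    show "(\<phi> ^^ m) ` supp U \<subseteq> (\<Union>V\<in>(S ^^ m) {U}. supp V)" if "U \<in> P" for U
      using S_pow(4)[OF sub[OF that], of m] by (simp add: pattern_supp_def)
  qed (use B \<mu>(1) \<phi>_pow in \<open>auto simp: pattern_supp_def\<close>)
  moreover have "(\<Sum>U\<in>P. vol ((\<phi> ^^ m) ` supp U \<inter> (\<Union>V\<in>(S ^^ m) {U} \<inter> kind i. supp V)) / vol (supp U)
         * vol (B \<inter> supp U)) = \<mu> ^ m * (\<Sum>j\<in>UNIV. dens m i j * covol j P B)"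
  proof -
    have ratio: "vol ((\<phi> ^^ m) ` supp U \<inter> (\<Union>V\<in>(S ^^ m) {U} \<inter> kind i. supp V)) / vol (supp U)
        = \<mu> ^ m * dens m i j" if U: "U \<in> kind j" for U j
    proof -
      obtain x where x: "U = translate_tile x (T j)" using U by auto
      have "vol (supp U) \<noteq> 0" using l_pos[of j] by (simp add: x measure_translation)
      then show ?thesis using covol_translated_supertile[OF x, of i m] by (simp add: covol_def)
    qed
    have "(\<Sum>U\<in>P. vol ((\<phi> ^^ m) ` supp U \<inter> (\<Union>V\<in>(S ^^ m) {U} \<inter> kind i. supp V)) / vol (supp U)
         * vol (B \<inter> supp U)) = (\<Sum>j\<in>UNIV. \<Sum>U\<in>P \<inter> kind j. \<mu> ^ m * dens m i j * vol (B \<inter> supp U))"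
      unfolding sum_kinds[OF P(1,3), symmetric]
      by (intro sum.cong refl arg_cong2[where f = "(*)"] ratio) blast
    also have "\<dots> = \<mu> ^ m * (\<Sum>j\<in>UNIV. dens m i j * covol j P B)"
      by (simp add: covol_eq_sum[OF P(1-3) B(1)] sum_distrib_left mult.assoc)
    finally show ?thesis .
  qed
  ultimately show ?thesis unfolding covol_def S_pow_UN[of m P] by simp
qed

text \<open>One inflation step applied to the supertile of order \<open>m\<close>, restricted to its
  inflated support.\<close>

lemma dens_Suc:
  "\<bar>dens (Suc m) i j - (\<Sum>p\<in>UNIV. dens 1 i p * dens m p j)\<bar>
    \<le> vol (thick_boundary R ((\<phi> ^^ m) ` supp (T j))) / (\<mu> ^ m * l j)"
proof -
  define P where "P = (S ^^ m) {T j}"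
  define B where "B = (\<phi> ^^ m) ` supp (T j)"
  have B: "B \<in> lmeasurable" unfolding B_def by (rule \<phi>_pow(5)[OF supp_T_lmeasurable])
  have "bounded B"
    unfolding B_def using \<phi>_pow(1) compact_T
    by (intro bounded_linear_image compact_imp_bounded) (simp_all add: linear_conv_bounded_linear)
  moreover have "B \<subseteq> pattern_supp P"
    using S_pow(4)[OF T_translates[of j], of m] by (simp add: B_def P_def pattern_supp_def)
  moreover have "is_patch ((S ^^ 1) P)" using patch_iterate[of "Suc m" j] by (simp add: P_def)
  ultimately have "\<bar>covol i ((S ^^ 1) P) ((\<phi> ^^ 1) ` B) - \<mu> ^ 1 * (\<Sum>p\<in>UNIV. dens 1 i p * covol p P B)\<bar>
      \<le> \<mu> ^ 1 * vol (thick_boundary R B)"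
    unfolding P_def using S_pow[OF T_translates[of j], of m] patch_iterate B
    by (intro covol_inflate) simp_all
  moreover have "covol i ((S ^^ 1) P) ((\<phi> ^^ 1) ` B) = \<mu> ^ Suc m * l j * dens (Suc m) i j"
    using covol_supertile[of i "Suc m" j] by (simp add: P_def B_def image_image)
  moreover have "(\<Sum>p\<in>UNIV. dens 1 i p * covol p P B)
      = \<mu> ^ m * l j * (\<Sum>p\<in>UNIV. dens 1 i p * dens m p j)"
    unfolding P_def B_def covol_supertile by (simp add: sum_distrib_left mult_ac)
  ultimately have "\<bar>\<mu> * (\<mu> ^ m * l j) * (dens (Suc m) i j - (\<Sum>p\<in>UNIV. dens 1 i p * dens m p j))\<bar>
      \<le> \<mu> * vol (thick_boundary R B)"
    by (simp add: algebra_simps)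
  then have "\<mu> * (\<bar>dens (Suc m) i j - (\<Sum>p\<in>UNIV. dens 1 i p * dens m p j)\<bar> * (\<mu> ^ m * l j))
      \<le> \<mu> * vol (thick_boundary R B)"
    using \<mu>(1) l_pos[of j] by (simp only: abs_mult power_abs abs_of_pos mult_ac)
  then show ?thesis
    using \<mu>(1) l_pos[of j] by (simp only: B_def mult_le_cancel_left_pos pos_le_divide_eq mult_pos_pos zero_less_power)
qed

text \<open>Deflated by \<open>\<psi> ^^ m\<close>, the \<open>R\<close>-boundary of an inflated
  support lies in a \<delta>-boundary of \<open>supp (T j)\<close>, whose volume is small as the
  frontier is null.\<close>

lemma thick_boundary_supertile:
  "(\<lambda>m. vol (thick_boundary R ((\<phi> ^^ m) ` supp (T j))) / (\<mu> ^ m * l j)) \<longlonglongrightarrow> 0"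
proof (rule LIMSEQ_I)
  fix e :: real assume e: "0 < e"
  have b: "bounded (supp (T j))" by (rule compact_imp_bounded[OF compact_T])
  obtain \<delta> where \<delta>: "0 < \<delta>" "vol (thick_boundary \<delta> (supp (T j))) < e * l j"
    using vol_thick_boundary_small[OF b null_frontier, of "e * l j"] e l_pos by auto
  \<comment> \<open>With this factor the radius \<open>R\<close> shrinks to
    \<open>\<delta> / 2\<close>, strictly below \<delta>.\<close>
  have c: "0 < \<delta> / (2 * R)" using \<delta> R(1) by simp
  obtain N where N: "\<And>m v. m \<ge> N \<Longrightarrow> norm ((\<psi> ^^ m) v) \<le> \<delta> / (2 * R) * norm v"
    using \<psi>_contracts[OF c] unfolding eventually_sequentially by blast
  show "\<exists>N. \<forall>m\<ge>N. norm (vol (thick_boundary R ((\<phi> ^^ m) ` supp (T j))) / (\<mu> ^ m * l j) - 0) < e"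
  proof (intro exI allI impI)
    fix m assume m: "N \<le> m"
    have "thick_boundary R ((\<phi> ^^ m) ` supp (T j)) \<subseteq> (\<phi> ^^ m) ` thick_boundary \<delta> (supp (T j))"
      using R(1) \<delta> c
      by (intro thick_boundary_linear_image[where g = "\<psi> ^^ m" and c = "\<delta> / (2 * R)"] N m \<phi>_pow) auto
    moreover have "bounded ((\<phi> ^^ m) ` supp (T j))"
      using b \<phi>_pow(1) by (intro bounded_linear_image) (simp_all add: linear_conv_bounded_linear)
    ultimately have "vol (thick_boundary R ((\<phi> ^^ m) ` supp (T j)))
        \<le> vol ((\<phi> ^^ m) ` thick_boundary \<delta> (supp (T j)))"
      using b by (intro measure_mono_fmeasurable fmeasurableD lmeasurable_thick_boundary \<phi>_pow) auto
    also have "\<dots> = \<mu> ^ m * vol (thick_boundary \<delta> (supp (T j)))"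
      by (intro \<phi>_pow lmeasurable_thick_boundary b)
    also have "\<dots> < \<mu> ^ m * (e * l j)" using \<mu>(1) \<delta> by (intro mult_strict_left_mono) auto
    finally have "vol (thick_boundary R ((\<phi> ^^ m) ` supp (T j))) < e * (\<mu> ^ m * l j)"
      by (simp add: mult_ac)
    then show "norm (vol (thick_boundary R ((\<phi> ^^ m) ` supp (T j))) / (\<mu> ^ m * l j) - 0) < e"
      using \<mu>(1) l_pos[of j] by (simp add: pos_divide_less_eq)
  qed
qed

text \<open>The sum over position vectors is a sum over tiles by injectivity, and null overlaps turn
  it into the volume of a union.\<close>

lemma substitution_matrix_eq:
  "substitution_matrix T \<phi> \<rho> $ i $ j = \<mu> * l j * dens 1 i j / l i"
proof -
  define B where "B = \<phi> ` supp (T j)"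
  have Tj: "S {T j} = \<rho> j"
    using subst_tile_translate[of 0 j] linear_0[OF \<phi>_linear] by (simp add: subst_pattern_def image_def)
  have inj: "inj_on (\<lambda>x. translate_tile x (T i)) X" for X
    by (auto simp: inj_on_def dest: translate_tile_T_inject)
  have B: "B \<in> lmeasurable" unfolding B_def using \<mu>(2)[OF supp_T_lmeasurable] by blast
  have "(\<Sum>x | translate_tile x (T i) \<in> \<rho> j. vol (supp (translate_tile x (T i)) \<inter> B))
      = (\<Sum>U\<in>(\<lambda>x. translate_tile x (T i)) ` {x. translate_tile x (T i) \<in> \<rho> j}. vol (B \<inter> supp U))"
    by (simp add: sum.reindex[OF inj] Int_commute)
  also have "(\<lambda>x. translate_tile x (T i)) ` {x. translate_tile x (T i) \<in> \<rho> j} = \<rho> j \<inter> kind i" by blast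
  also have "(\<Sum>U\<in>\<rho> j \<inter> kind i. vol (B \<inter> supp U)) = covol i (\<rho> j) B"
    using patch_iterate[of 1 j] by (intro covol_eq_sum[symmetric] \<rho> B) (simp add: Tj)
  also have "\<dots> = \<mu> * l j * dens 1 i j"
    using covol_supertile[of i 1 j] by (simp add: Tj B_def)
  finally show ?thesis
    by (simp add: substitution_matrix_def B_def flip: sum_divide_distrib)
qed

text \<open>Conjugating the substitution matrix by the tile volumes and rescaling turns it into the
  stochastic matrix of the \<open>dens 1 i j\<close>, with stationary vector \<open>l i * r i\<close>. The numbers
  \<open>dens m i j\<close> are not the entries of its powers (tiles may stick out of the inflated supports),
  but the discrepancy is a boundary effect.\<close>

lemma dens_tendsto:
  assumes prim: "primitive_matrix (substitution_matrix T \<phi> \<rho>)"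
    and r: "substitution_matrix T \<phi> \<rho> *v r = c *s r" "(\<Sum>i\<in>UNIV. l i * r $ i) = 1"
  shows "(\<lambda>m. dens m i j) \<longlonglongrightarrow> l i * r $ i"
proof -
  define M where "M = substitution_matrix T \<phi> \<rho>"
  define N :: "real ^ 'k ^ 'k" where "N = (\<chi> i j. dens 1 i j)"
  define p :: "real ^ 'k" where "p = (\<chi> i. l i * r $ i)"
  have M: "l i * M $ i $ j = \<mu> * (N $ i $ j * l j)" for i j
    using l_pos[of i] by (simp add: M_def N_def substitution_matrix_eq)
  obtain q where q: "q > 0" "\<And>i j. 0 < (((**) M ^^ q) (mat 1)) $ i $ j"
    using prim unfolding primitive_matrix_def M_def by blast
  \<comment> \<open>With \<open>D\<close> the diagonal matrix of tile volumes,
    \<open>D M = \<mu> N D\<close>; iterating this carries positivity from a power of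
    \<open>M\<close> to the same power of \<open>N\<close>.\<close>
  have pow: "l i * (((**) M ^^ n) (mat 1)) $ i $ j = \<mu> ^ n * ((((**) N ^^ n) (mat 1)) $ i $ j * l j)" for n i j
  proof (induction n arbitrary: i j)
    case (Suc n)
    have "l i * (((**) M ^^ Suc n) (mat 1)) $ i $ j
        = (\<Sum>s\<in>UNIV. (l i * M $ i $ s) * (((**) M ^^ n) (mat 1)) $ s $ j)"
      by (simp add: matrix_matrix_mult_def sum_distrib_left mult.assoc)
    also have "\<dots> = (\<Sum>s\<in>UNIV. \<mu> * N $ i $ s * (l s * (((**) M ^^ n) (mat 1)) $ s $ j))"
      unfolding M by (simp add: mult_ac)
    also have "\<dots> = \<mu> ^ Suc n * ((((**) N ^^ Suc n) (mat 1)) $ i $ j * l j)"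
      unfolding Suc by (simp add: matrix_matrix_mult_def sum_distrib_left sum_distrib_right mult_ac)
    finally show ?case .
  qed (simp add: mat_def)
  have Mr: "(\<Sum>j\<in>UNIV. l i * M $ i $ j * r $ j) = c * (l i * r $ i)" for i
  proof -
    have "(M *v r) $ i = c * r $ i" using r(1) by (simp add: M_def)
    then show ?thesis
      by (simp add: matrix_vector_mult_def mult.assoc flip: sum_distrib_left)
  qed
  have Np: "\<mu> * (N *v p) $ i = c * p $ i" for i
    using Mr[of i] unfolding M by (simp add: p_def matrix_vector_mult_def sum_distrib_left mult_ac)
  have sum_p: "(\<Sum>i\<in>UNIV. p $ i) = 1" using r(2) by (simp add: p_def)
  have col: "(\<Sum>i\<in>UNIV. N $ i $ j) = 1" for j by (simp add: N_def sum_dens del: One_nat_def)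
  have "(\<Sum>i\<in>UNIV. (N *v p) $ i) = (\<Sum>j\<in>UNIV. (\<Sum>i\<in>UNIV. N $ i $ j) * p $ j)"
    by (simp add: matrix_vector_mult_def sum_distrib_right) (rule sum.swap)
  also have "\<dots> = 1" using col sum_p by simp
  \<comment> \<open>Summing coordinates identifies the eigenvalue: \<open>N\<close> preserves
    coordinate sums and \<open>p\<close> has sum 1, so \<open>c = \<mu>\<close>.\<close>
  finally have "\<mu> * 1 = c * 1"
    using sum_distrib_left[of \<mu> "\<lambda>i. (N *v p) $ i" UNIV] Np sum_p
    by (simp flip: sum_distrib_left)
  then have p: "N *v p = p" using Np \<mu>(1) by (simp add: vec_eq_iff)
  define a :: "nat \<Rightarrow> real ^ 'k" where "a m = (\<chi> i. dens m i j)" for m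
  have "(\<lambda>m. a m $ i) \<longlonglongrightarrow> p $ i"
  proof (rule perturbed_stochastic_iteration[OF _ col _ q(1) p sum_p])
    show "0 \<le> N $ i $ j" for i j by (simp add: N_def dens_nonneg)
    show "0 < (((**) N ^^ q) (mat 1)) $ i $ j" for i j
    proof -
      have "0 < \<mu> ^ q * ((((**) N ^^ q) (mat 1)) $ i $ j * l j)"
        unfolding pow[symmetric] using q(2) l_pos by simp
      then show ?thesis using \<mu>(1) l_pos[of j] by (simp add: zero_less_mult_iff)
    qed
    show "(\<Sum>i\<in>UNIV. a m $ i) = 1" for m by (simp add: a_def sum_dens)
    show "(\<lambda>m. a (Suc m) $ i - (N *v a m) $ i) \<longlonglongrightarrow> 0" for i
    proof (rule Lim_null_comparison[OF always_eventually thick_boundary_supertile[of j]], intro allI)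
      show "norm (a (Suc m) $ i - (N *v a m) $ i)
          \<le> vol (thick_boundary R ((\<phi> ^^ m) ` supp (T j))) / (\<mu> ^ m * l j)" for m
        using dens_Suc[of m i j] by (simp add: a_def N_def matrix_vector_mult_def)
    qed
  qed
  then show ?thesis by (simp add: a_def p_def)
qed

section \<open>From covered volumes to numbers of tiles\<close>

text \<open>A tile lying together with its position vector inside \<open>A\<close>, or outside
  \<open>A\<close>, contributes equally to both quantities. Every other tile lies in the thick
  boundary.\<close>

lemma count_minus_covol:
  assumes Q: "finite Q" "is_patch Q" "Q \<subseteq> translates_of T" and A: "A \<in> lmeasurable" "bounded A"
  shows "\<bar>l i * real (card {y \<in> A. translate_tile y (T i) \<in> Q}) - covol i Q A\<bar> \<le> vol (thick_boundary R A)"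
proof -
  define t where "t y = translate_tile y (T i)" for y
  have inj: "inj_on t X" for X
    by (auto simp: inj_on_def t_def dest: translate_tile_T_inject)
  define Y where "Y = {y. t y \<in> Q}"
  have tY: "t ` Y = Q \<inter> kind i" by (auto simp: Y_def t_def)
  then have fin: "finite Y" using Q(1) inj by (metis finite_Int finite_imageD)
  have vol_t: "vol (supp (t y)) = l i" for y by (simp add: t_def measure_translation)
  have "covol i Q A = (\<Sum>y\<in>Y. vol (A \<inter> supp (t y)))"
    unfolding covol_eq_sum[OF Q A(1)] tY[symmetric] by (rule sum.reindex[OF inj, unfolded comp_def])
  moreover have "l i * real (card {y \<in> A. t y \<in> Q}) = (\<Sum>y\<in>Y. if y \<in> A then vol (supp (t y)) else 0)"
  proof -
    have "(\<Sum>y\<in>Y. if y \<in> A then vol (supp (t y)) else 0) = (\<Sum>y\<in>{y \<in> Y. y \<in> A}. l i)"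
      unfolding vol_t by (rule sum.inter_filter[OF fin, symmetric])
    also have "{y \<in> Y. y \<in> A} = {y \<in> A. t y \<in> Q}" by (auto simp: Y_def)
    finally show ?thesis by simp
  qed
  ultimately have eq: "l i * real (card {y \<in> A. t y \<in> Q}) - covol i Q A
      = (\<Sum>y\<in>Y. (if y \<in> A then vol (supp (t y)) else 0) - vol (A \<inter> supp (t y)))"
    by (simp add: sum_subtractf)
  define Y' where "Y' = {y \<in> Y. insert y (supp (t y)) \<inter> A \<noteq> {} \<and> \<not> insert y (supp (t y)) \<subseteq> A}"
  have bnd: "\<bar>(if y \<in> A then vol (supp (t y)) else 0) - vol (A \<inter> supp (t y))\<bar>
      \<le> (if y \<in> Y' then vol (supp (t y)) else 0)" if y: "y \<in> Y" for y
  proof (cases "y \<in> Y'")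
    case True
    have "supp (t y) \<in> lmeasurable"
      using y Q(3) supp_compact by (auto simp: Y_def intro: lmeasurable_compact)
    then have "vol (A \<inter> supp (t y)) \<le> vol (supp (t y))"
      using A(1) by (intro measure_mono_fmeasurable) auto
    then show ?thesis using True measure_nonneg[of lebesgue "A \<inter> supp (t y)"] by auto
  next
    case False
    then consider "y \<notin> A" "A \<inter> supp (t y) = {}" | "y \<in> A" "A \<inter> supp (t y) = supp (t y)"
      using y by (auto simp: Y'_def)
    then show ?thesis using False by cases auto
  qed
  have "\<bar>l i * real (card {y \<in> A. t y \<in> Q}) - covol i Q A\<bar>
      \<le> (\<Sum>y\<in>Y. if y \<in> Y' then vol (supp (t y)) else 0)"
    unfolding eq by (rule order_trans[OF sum_abs sum_mono[OF bnd]])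
  also have "\<dots> = (\<Sum>y\<in>Y'. vol (supp (t y)))"
    using fin by (intro sum.mono_neutral_cong_right) (auto simp: Y'_def)
  also have "\<dots> = (\<Sum>U\<in>t ` Y'. vol (supp U))"
    by (rule sum.reindex[OF inj, unfolded comp_def, symmetric])
  also have "\<dots> \<le> vol (thick_boundary R A)"
  proof (rule sum_vol_le)
    show "ae_disjoint supp (t ` Y')"
      by (rule ae_disjoint_subset[OF ae_disjoint_patch[OF Q]]) (auto simp: Y'_def Y_def)
    show "supp U \<subseteq> thick_boundary R A" if "U \<in> t ` Y'" for U
    proof -
      obtain y where y: "y \<in> Y'" "U = t y" using \<open>U \<in> t ` Y'\<close> by blast
      have "insert y (supp (t y)) \<subseteq> thick_boundary R A"
      proof (rule subset_thick_boundary)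
        show "dist x z < R" if "x \<in> insert y (supp (t y))" "z \<in> insert y (supp (t y))" for x z
          using that unfolding t_def by (rule dist_less_R)
      qed (use y in \<open>auto simp: Y'_def\<close>)
      then show ?thesis using y by blast
    qed
  qed (rule lmeasurable_thick_boundary[OF A(2)])
  finally show ?thesis unfolding t_def .
qed

text \<open>Here \<pi> is an arbitrary number. As it does not depend on \<open>j\<close>, the
  mixture of types in the deflated region does not matter. One boundary term comes from counting,
  which needs \<open>R \<le> L\<close>; the other comes from tiles cut by the deflated boundary,
  which needs \<open>L\<close> above the stretched radius \<open>c * R\<close>.\<close>

lemma count_estimate:
  assumes tiling: "is_tiling \<T>" "\<T> \<subseteq> translates_of T" "(S ^^ m) \<T> = \<T>"
    and dens: "\<And>j. \<bar>dens m i j - \<pi>\<bar> \<le> \<epsilon>"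
    and L: "\<And>v. norm ((\<phi> ^^ m) v) \<le> c * norm v" "0 \<le> c" "c * R < L" "R \<le> L"
    and A: "A \<in> lmeasurable" "bounded A"
  shows "\<bar>l i * real (card {y \<in> A. translate_tile y (T i) \<in> \<T>}) - \<pi> * vol A\<bar>
    \<le> \<epsilon> * vol A + 2 * vol (thick_boundary L A)"
proof -
  have patch: "is_patch \<T>" and cover: "pattern_supp \<T> = UNIV"
    using tiling(1) by (auto simp: is_tiling_def)
  define B where "B = (\<psi> ^^ m) ` A"
  have bB: "bounded B"
    unfolding B_def using A(2) \<phi>_pow(4) by (intro bounded_linear_image) (simp_all add: linear_conv_bounded_linear)
  have \<phi>B: "(\<phi> ^^ m) ` B = A" by (simp add: B_def image_image \<phi>_pow)
  have \<psi>_scales: "(\<psi> ^^ m) ` X \<in> lmeasurable \<and> \<mu> ^ m * vol ((\<psi> ^^ m) ` X) = vol X"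
    if "X \<in> lmeasurable" for X
  proof -
    have "(\<psi> ^^ m) ` X \<in> lmeasurable"
      using linear_image_scales_vol[OF \<phi>_pow(4)[of m]] that by blast
    then show ?thesis using \<phi>_pow(6)[of "(\<psi> ^^ m) ` X" m] by (simp add: image_image \<phi>_pow)
  qed
  have B: "B \<in> lmeasurable" "\<mu> ^ m * vol B = vol A" using \<psi>_scales[OF A(1)] by (auto simp: B_def)
  define P where "P = {U \<in> \<T>. supp U \<inter> B \<noteq> {}}"
  have P: "finite P" "is_patch P" "P \<subseteq> translates_of T" "P \<subseteq> \<T>"
    unfolding P_def using tiling(2) locally_finite[OF patch tiling(2) bB] is_patch_subset[OF patch] by auto
  have BP: "B \<subseteq> pattern_supp P"
    using cover by (fastforce simp: pattern_supp_def P_def)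
  have SP: "(S ^^ m) P \<subseteq> \<T>" using S_pow_mono[OF P(4), of m] tiling(3) by simp
  define D where "D = (\<Union>a\<in>A. ball a R)"
  have "bounded D"
  proof -
    obtain b where "\<And>a. a \<in> A \<Longrightarrow> norm a \<le> b" using A(2) by (auto simp: bounded_iff)
    then have "norm x \<le> b + R" if "a \<in> A" "dist a x < R" for a x
      using norm_triangle_ineq2[of x a] that by (force simp: dist_norm norm_minus_commute)
    then show ?thesis unfolding bounded_iff D_def by (intro exI[of _ "b + R"]) auto
  qed
  \<comment> \<open>A finite patch containing both the supertiles that cover \<open>A\<close> and
    every tile positioned in \<open>A\<close>. The latter may miss \<open>A\<close> itself, hence
    the neighbourhood \<open>D\<close>.\<close>
  define Q where "Q = (S ^^ m) P \<union> {U \<in> \<T>. supp U \<inter> D \<noteq> {}}"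
  have Q: "finite Q" "is_patch Q" "Q \<subseteq> translates_of T" "Q \<subseteq> \<T>"
    unfolding Q_def using S_pow(2)[OF P(3,1), of m] SP tiling(2)
      locally_finite[OF patch tiling(2) \<open>bounded D\<close>] is_patch_subset[OF patch] by auto
  have "translate_tile y (T i) \<in> Q" if "y \<in> A" "translate_tile y (T i) \<in> \<T>" for y
  proof -
    have "supp (T i) \<noteq> {}" using tile_T[of i] unfolding is_tile_def by simp
    then obtain x where x: "x \<in> supp (translate_tile y (T i))" by auto
    then have "dist y x < R" by (intro dist_less_R) auto
    then have "x \<in> D" using \<open>y \<in> A\<close> unfolding D_def by auto
    with x that(2) show ?thesis unfolding Q_def by blast
  qed
  then have "{y \<in> A. translate_tile y (T i) \<in> \<T>} = {y \<in> A. translate_tile y (T i) \<in> Q}"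
    using Q(4) by blast
  then have 1: "\<bar>l i * real (card {y \<in> A. translate_tile y (T i) \<in> \<T>}) - covol i Q A\<bar>
      \<le> vol (thick_boundary R A)"
    using count_minus_covol[OF Q(1-3) A] by simp
  have "A \<subseteq> pattern_supp ((S ^^ m) P)"
    using S_pow(4)[OF P(3), of m] image_mono[OF BP, of "\<phi> ^^ m"] unfolding \<phi>B by blast
  \<comment> \<open>The supertiles already cover \<open>A\<close>, so the additional tiles of
    \<open>Q\<close> meet \<open>A\<close> in null sets.\<close>
  then have 2: "covol i Q A = covol i ((S ^^ m) P) A"
    unfolding covol_def pattern_supp_def
    by (intro vol_Int_UN_subfamily[OF ae_disjoint_patch[OF Q(1-3)]] A) (auto simp: Q_def)
  have 3: "\<bar>covol i ((S ^^ m) P) A - \<mu> ^ m * (\<Sum>j\<in>UNIV. dens m i j * covol j P B)\<bar>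
      \<le> \<mu> ^ m * vol (thick_boundary R B)"
    using covol_inflate[OF P(1-3) is_patch_subset[OF patch SP] B(1) bB BP] unfolding \<phi>B .
  have 4: "\<mu> ^ m * vol (thick_boundary R B) \<le> vol (thick_boundary L A)"
  proof -
    have tA: "thick_boundary L A \<in> lmeasurable" by (rule lmeasurable_thick_boundary[OF A(2)])
    have "thick_boundary R B \<subseteq> (\<psi> ^^ m) ` thick_boundary L A"
      unfolding B_def by (intro thick_boundary_linear_image[where g = "\<phi> ^^ m" and c = c] \<phi>_pow L)
    then have "vol (thick_boundary R B) \<le> vol ((\<psi> ^^ m) ` thick_boundary L A)"
      using \<psi>_scales[OF tA] by (intro measure_mono_fmeasurable fmeasurableD lmeasurable_thick_boundary bB) auto
    then have "\<mu> ^ m * vol (thick_boundary R B) \<le> \<mu> ^ m * vol ((\<psi> ^^ m) ` thick_boundary L A)"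
      using \<mu>(1) by (intro mult_left_mono) auto
    then show ?thesis using \<psi>_scales[OF tA] by simp
  qed
  have 5: "\<bar>\<mu> ^ m * (\<Sum>j\<in>UNIV. dens m i j * covol j P B) - \<pi> * vol A\<bar> \<le> \<epsilon> * vol A"
  proof -
    have sum: "\<mu> ^ m * (\<Sum>j\<in>UNIV. covol j P B) = vol A"
      using sum_covol[OF P(1-3) B(1) BP] B(2) by simp
    have "\<mu> ^ m * (\<Sum>j\<in>UNIV. dens m i j * covol j P B) - \<pi> * vol A
        = \<mu> ^ m * (\<Sum>j\<in>UNIV. (dens m i j - \<pi>) * covol j P B)"
      unfolding sum[symmetric] by (simp add: algebra_simps sum_subtractf sum_distrib_left)
    also have "\<bar>\<dots>\<bar> \<le> \<mu> ^ m * (\<Sum>j\<in>UNIV. \<epsilon> * covol j P B)"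
      using \<mu>(1) dens
      by (auto simp: abs_mult covol_def intro!: mult_left_mono order_trans[OF sum_abs] sum_mono mult_right_mono)
    also have "\<dots> = \<epsilon> * vol A" unfolding sum[symmetric] by (simp add: sum_distrib_left mult_ac)
    finally show ?thesis .
  qed
  have 6: "vol (thick_boundary R A) \<le> vol (thick_boundary L A)"
    by (rule vol_thick_boundary_mono[OF A(2) L(4)])
  show ?thesis using 1 2 3 4 5 6 by linarith
qed

end

subsection \<open>Frequencies\<close>

theorem theorem2p8:
  fixes T :: "'k::finite \<Rightarrow> ('d::finite, 'l::finite) tile"
    and \<phi> :: "real ^ 'd \<Rightarrow> real ^ 'd"
    and \<rho> :: "'k \<Rightarrow> ('d, 'l) tile set"
    and l r :: "real ^ 'k"
    and \<T> :: "('d, 'l) tile set"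
    and k :: nat
    and A :: "nat \<Rightarrow> (real ^ 'd) set"
  assumes "overlapping_substitution T \<phi> \<rho>"
    and "expanding T \<phi> \<rho>"
    and "\<And>i. negligible (frontier (supp (T i)))"
    and "primitive_matrix (substitution_matrix T \<phi> \<rho>)"
    and "right_PF_eigenvector (substitution_matrix T \<phi> \<rho>) r"
    and "left_PF_eigenvector (substitution_matrix T \<phi> \<rho>) l"
    and "\<And>i. l $ i = vol (supp (T i))"
    and "(\<Sum>i\<in>UNIV. l $ i * r $ i) = 1"
    and "(\<Sum>i\<in>UNIV. r $ i) = 1"
    and "is_tiling \<T>"
    and "\<T> \<subseteq> translates_of T"
    and "k > 0"
    and "(subst_pattern T \<phi> \<rho> ^^ k) \<T> = \<T>"
    and "van_Hove A"
  shows "\<forall>i.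
      (\<forall>x :: nat \<Rightarrow> real ^ 'd.
         (\<lambda>n. real (card {y \<in> (+) (x n) ` A n. translate_tile y (T i) \<in> \<T>}) / vol (A n))
           \<longlonglongrightarrow> r $ i) \<and>
      uniform_limit UNIV
         (\<lambda>n z. real (card {y \<in> (+) z ` A n. translate_tile y (T i) \<in> \<T>}) / vol (A n))
         (\<lambda>_. r $ i) sequentially"
proof (intro allI conjI)
  fix i
  have pre: "pre_overlapping_substitution T \<phi> \<rho>"
    by (rule assms(1)[unfolded overlapping_substitution_def, THEN conjunct1])
  have lin: "linear \<phi>" and eig: "\<And>z. z \<in> eigenvalues (matrix \<phi>) \<Longrightarrow> 1 < cmod z"
    using pre unfolding pre_overlapping_substitution_def by simp_all
  obtain \<psi> where \<psi>: "linear \<psi>" "\<And>x. \<phi> (\<psi> x) = x" "\<And>x. \<psi> (\<phi> x) = x"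
    "\<And>e. 0 < e \<Longrightarrow> \<forall>\<^sub>F m in sequentially. \<forall>v. norm ((\<psi> ^^ m) v) \<le> e * norm v"
    using ex_contracting_inverse[OF lin eig] by blast
  obtain \<mu> where \<mu>: "0 \<le> \<mu>"
    "\<And>S. S \<in> lmeasurable \<Longrightarrow> \<phi> ` S \<in> lmeasurable \<and> vol (\<phi> ` S) = \<mu> * vol S"
    using linear_image_scales_vol[OF lin] by blast
  \<comment> \<open>With factor 0 the unit ball, being the image under \<phi> of its own preimage,
    would be null.\<close>
  have "\<mu> \<noteq> 0"
  proof
    assume 0: "\<mu> = 0"
    have "\<psi> ` X \<in> lmeasurable" if "X \<in> lmeasurable" for X
      using linear_image_scales_vol[OF \<psi>(1)] that by blast
    from this[OF lmeasurable_ball] have "vol (\<phi> ` \<psi> ` ball 0 1) = 0" using \<mu>(2) 0 by simp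
    moreover have "\<phi> ` \<psi> ` ball 0 1 = ball 0 1" by (simp add: image_image \<psi>)
    ultimately have "negligible (ball (0 :: real ^ 'd) 1)" by (simp add: negligible_iff_measure)
    then show False using open_not_negligible[of "ball (0 :: real ^ 'd) 1"] by simp
  qed
  then have "0 < \<mu>" using \<mu>(1) by simp
  interpret I: inflation_substitution T \<phi> \<psi> \<rho> \<mu>
    by (rule inflation_substitution.intro[OF assms(1-3) \<psi> \<open>0 < \<mu>\<close> \<mu>(2)])
  have l: "l $ j = vol (supp (T j))" for j by (rule assms(7))
  have li: "0 < l $ i" using I.l_pos l by simp
  obtain c where c: "substitution_matrix T \<phi> \<rho> *v r = c *s r"
    using assms(5) unfolding right_PF_eigenvector_def by blast
  have lr: "(\<Sum>i\<in>UNIV. vol (supp (T i)) * r $ i) = 1" using assms(8) l by simp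
  have lim: "(\<lambda>m. I.dens m i j) \<longlonglongrightarrow> l $ i * r $ i" for j
    using I.dens_tendsto[OF assms(4) c lr] l by simp
  have fixed: "(subst_pattern T \<phi> \<rho> ^^ (k * n)) \<T> = \<T>" for n
    by (induction n) (simp_all add: funpow_add assms(13))
  have A: "A n \<in> lmeasurable" "bounded (A n)" "0 < vol (A n)" for n
    using assms(14) unfolding van_Hove_def by (auto intro: bounded_set_imp_lmeasurable)
  show unif: "uniform_limit UNIV
         (\<lambda>n z. real (card {y \<in> (+) z ` A n. translate_tile y (T i) \<in> \<T>}) / vol (A n))
         (\<lambda>_. r $ i) sequentially"
    unfolding uniform_limit_iff
  proof (intro allI impI)
    fix e :: real assume e: "0 < e"
    \<comment> \<open>Dividing by \<open>l $ i * vol (A n)\<close> later leaves exactly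
      \<open>e / 2\<close>.\<close>
    define \<epsilon> where "\<epsilon> = l $ i * e / 2"
    have \<epsilon>: "0 < \<epsilon>" using e li by (simp add: \<epsilon>_def)
    have "\<forall>\<^sub>F m in sequentially. \<forall>j. \<bar>I.dens m i j - l $ i * r $ i\<bar> \<le> \<epsilon>"
    proof (rule eventually_all_finite)
      fix j
      from tendstoD[OF lim[of j] \<epsilon>]
      show "\<forall>\<^sub>F m in sequentially. \<bar>I.dens m i j - l $ i * r $ i\<bar> \<le> \<epsilon>"
        by (rule eventually_mono) (simp add: dist_real_def)
    qed
    then obtain n0 where n0: "\<And>m j. m \<ge> n0 \<Longrightarrow> \<bar>I.dens m i j - l $ i * r $ i\<bar> \<le> \<epsilon>"
      unfolding eventually_sequentially by blast
    \<comment> \<open>A multiple of \<open>k\<close>, so that the tiling is fixed by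
      \<open>m\<close> substitutions, and at least \<open>n0\<close> because \<open>k\<close> is
      positive.\<close>
    define m where "m = k * n0"
    have m: "\<bar>I.dens m i j - l $ i * r $ i\<bar> \<le> \<epsilon>" for j
      using n0[of m j] assms(12) by (simp add: m_def)
    obtain b where b: "0 < b" "\<And>v. norm ((\<phi> ^^ m) v) \<le> b * norm v"
      using linear_bounded_pos[OF I.\<phi>_pow(1)] by blast
    \<comment> \<open>The radius depends on \<open>m\<close> only, so it is constant while
      \<open>n\<close> and \<open>z\<close> vary.\<close>
    define L where "L = b * I.R + I.R"
    have L: "0 \<le> b" "b * I.R < L" "I.R \<le> L" "0 < L" using b I.R(1) by (auto simp: L_def add_pos_pos)
    \<comment> \<open>The right-hand side is free of \<open>z\<close>, as volumes and thick
      boundaries are compatible with translations.\<close>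
    have est: "\<bar>real (card {y \<in> (+) z ` A n. translate_tile y (T i) \<in> \<T>}) / vol (A n) - r $ i\<bar>
        \<le> e / 2 + 2 / l $ i * (vol (thick_boundary L (A n)) / vol (A n))" for n z
    proof -
      define C where "C = real (card {y \<in> (+) z ` A n. translate_tile y (T i) \<in> \<T>})"
      have "(+) z ` A n \<in> lmeasurable" "bounded ((+) z ` A n)"
        using A by (auto intro: measurable_translation bounded_translation)
      from I.count_estimate[OF assms(10,11) fixed[of n0, folded m_def] m b(2) L(1-3) this]
      have "\<bar>l $ i * C - l $ i * r $ i * vol (A n)\<bar>
          \<le> \<epsilon> * vol (A n) + 2 * vol (thick_boundary L (A n))"
        by (simp add: C_def l thick_boundary_translation measure_translation)
      moreover have "l $ i * C - l $ i * r $ i * vol (A n) = l $ i * vol (A n) * (C / vol (A n) - r $ i)"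
        using A(3)[of n] by (simp add: field_simps)
      ultimately have "l $ i * vol (A n) * \<bar>C / vol (A n) - r $ i\<bar>
          \<le> \<epsilon> * vol (A n) + 2 * vol (thick_boundary L (A n))"
        using A(3)[of n] li by (simp only: abs_mult abs_of_pos)
      also have "\<dots> = l $ i * vol (A n) * (e / 2 + 2 / l $ i * (vol (thick_boundary L (A n)) / vol (A n)))"
        using A(3)[of n] li by (simp add: \<epsilon>_def field_simps)
      finally show ?thesis
        using A(3)[of n] li by (simp only: C_def mult_le_cancel_left_pos mult_pos_pos)
    qed
    have "(\<lambda>n. 2 / l $ i * (vol (thick_boundary L (A n)) / vol (A n))) \<longlonglongrightarrow> 2 / l $ i * 0"
      using assms(14) L(4) unfolding van_Hove_def by (intro tendsto_mult_left) blast
    then have "\<forall>\<^sub>F n in sequentially. 2 / l $ i * (vol (thick_boundary L (A n)) / vol (A n)) < e / 2"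
      by (rule order_tendstoD) (use e in simp)
    then show "\<forall>\<^sub>F n in sequentially. \<forall>z\<in>UNIV.
        dist (real (card {y \<in> (+) z ` A n. translate_tile y (T i) \<in> \<T>}) / vol (A n)) (r $ i) < e"
    proof (rule eventually_mono, intro ballI)
      fix n z assume "2 / l $ i * (vol (thick_boundary L (A n)) / vol (A n)) < e / 2"
      with est[of z n]
      show "dist (real (card {y \<in> (+) z ` A n. translate_tile y (T i) \<in> \<T>}) / vol (A n)) (r $ i) < e"
        unfolding dist_real_def by linarith
    qed
  qed
  fix x :: "nat \<Rightarrow> real ^ 'd"
  show "(\<lambda>n. real (card {y \<in> (+) (x n) ` A n. translate_tile y (T i) \<in> \<T>}) / vol (A n)) \<longlonglongrightarrow> r $ i"
  proof (rule tendstoI)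
    fix e :: real assume "0 < e"
    from uniform_limitD[OF unif this]
    show "\<forall>\<^sub>F n in sequentially.
        dist (real (card {y \<in> (+) (x n) ` A n. translate_tile y (T i) \<in> \<T>}) / vol (A n)) (r $ i) < e"
      by (rule eventually_mono) blast
  qed
qed

end
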